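(* Let $p,q\in[1,\infty]$ and $\ell\ge0$. Consider an alternative basis matrix multiplication algorithm given by $\phi\in\mathbb{R}^{e'\times e}$, $\psi\in\mathbb{R}^{f'\times f}$, $\nu\in\mathbb{R}^{g'\times g}$ and $L^\phi\in\mathbb{R}^{r\times e'}$, $R^\psi\in\mathbb{R}^{r\times f'}$, $P^\nu\in\mathbb{R}^{g'\times r}$, with bilinear base case $\beta^{(0)}:\mathbb{R}^{e_0}\times\mathbb{R}^{f_0}\to\mathbb{R}^{g_0}$. Then for all $u\in\mathbb{R}^{e_0e^\ell}$, $v\in\mathbb{R}^{f_0f^\ell}$, the value $\widehat{\beta_{\mathrm{mmab}}^{\otimes^\ell}(u,v)}$ computed by this algorithm in floating point arithmetic with machine precision $\varepsilon$ satisfies $$\left\|\widehat{\beta_{\mathrm{mmab}}^{\otimes^\ell}(u,v)}-\beta_{\mathrm{mmab}}^{\otimes^\ell}(u,v)\right\|_p\le f^{(\ell)}_{p,q}\,\|u\|_q\|v\|_q\,\varepsilon+O(\varepsilon^2),$$ where $$f^{(\ell)}_{p,q}=\bigl(\gamma_{p,q}(\mathrm{mmab})\bigr)^\ell\Bigl(f^{(0)}_{p,q}+\gamma^{(0)}_{p,q}\,\ell\,\bigl(Q_0+Q_\phi+Q_\psi+Q_{\nu^{\intercal}}\bigr)\Bigr)$$ with $$\gamma_{p,q}(\mathrm{mmab})=\gamma_{p,q}(\mathrm{ab})\,\|\phi\|_q\,\|\psi\|_q\,\|\nu^{\intercal}\|_p.$$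
   Context: **Norms.** $\|\cdot\|_p,\|\cdot\|_q$ are the usual $\ell_p,\ell_q$ norms of real vectors; $\|\cdot\|_{p^\star},\|\cdot\|_{q^\star}$ their dual norms. $\|x\|_0$ is the number of nonzero entries. $A_{i,*}$, $A_{*,i}$ are the $i$-th row and column of $A$. For a matrix $A$, $\|A\|_q:=\bigl\|(\|A_{i,*}\|_{q^\star})_i\bigr\|_q$ (similarly with $p$), and $Q_A:=\max_i\|A_{i,*}\|_0$. **Algorithm.** The sparsified recursive bilinear map $\beta_{\mathrm{ab}}^{\otimes^\ell}:\mathbb{R}^{e_0e'^\ell}\times\mathbb{R}^{f_0f'^\ell}\to\mathbb{R}^{g_0g'^\ell}$ is defined by $\beta_{\mathrm{ab}}^{\otimes^0}=\beta^{(0)}$ and $$\beta_{\mathrm{ab}}^{\otimes^\ell}(u,v)=\sum_{i=1}^rP^\nu_{*,i}\,\beta_{\mathrm{ab}}^{\otimes^{\ell-1}}(L^\phi_{i,*}\cdot u,\,R^\psi_{i,*}\cdot v).$$ Here $L^\phi_{i,*}\cdot u=\sum_jl^\phi_{i,j}u_j$ with $u$ cut into $e'$ contiguous blocks $u_j$ of length $e_0e'^{\ell-1}$ (similarly for $v$ with $f'$ blocks), and multiplication by $P^\nu_{*,i}$ produces $g'$ contiguous output blocks. The alternative basis algorithm is $$\beta_{\mathrm{mmab}}^{\otimes^\ell}(u,v)=(\nu^{\otimes^\ell})^{\intercal}\,\beta_{\mathrm{ab}}^{\otimes^\ell}(\phi^{\otimes^\ell}\cdot u,\ \psi^{\otimes^\ell}\cdot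 v),$$ equivalently $\beta_{\mathrm{mmab}}^{\otimes^0}=\beta^{(0)}$ and $\beta_{\mathrm{mmab}}^{\otimes^\ell}(u,v)=\nu^{\intercal}\cdot\sum_iP^\nu_{*,i}\,\beta_{\mathrm{mmab}}^{\otimes^{\ell-1}}(L^\phi_{i,*}\cdot\phi\cdot u,\,R^\psi_{i,*}\cdot\psi\cdot v)$. The tensor powers act on $\mathbb{R}^{e_0e^\ell}$, $\mathbb{R}^{f_0f^\ell}$, $\mathbb{R}^{g_0g'^\ell}$ recursively by blocks, the leaves of length $e_0,f_0,g_0$ being treated as scalars (i.e. $\phi^{\otimes^\ell}$ means $\phi^{\otimes\ell}\otimes I_{e_0}$, etc.). The algorithm being a matrix multiplication algorithm means that $[L^\phi\phi;\,R^\psi\psi;\,\nu^{\intercal}P^\nu]$ represents an $m\times k$ by $k\times n$ matrix product ($e=mk$, $f=kn$, $g=mn$), where $[L;R;P]$ represents $\beta$ if $\beta(u,v)=\sum_iP_{*,i}(L_{i,*}\cdot u)(R_{i,*}\cdot v)$. It is executed by first computing $\phi^{\otimes^\ell}\cdot u$ and $\psi^{\otimes^\ell}\cdot v$ (one factor at a time, level by level), then $\beta_{\mathrm{ab}}^{\otimes^\ell}$ recursively on the computed inputs, then applying $(\nu^{\intercal})^{\otimes^\ell}$ level by level. **Constants.** - $\gamma_{p,q}(\mathrm{ab})=\bigl\|\bigl(\sum_{i=1}^r\|L^\phi_{i,*}\|_{q^\star}\|R^\psi_{i,*}\|_{q^\star}|p^\nu_{j,i}|\bigr)_j\bigr\|_p$.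 - $Q_0=\max_j\bigl(\|P^\nu_{j,*}\|_0+\max_i(\|L^\phi_{i,*}\|_0+\|R^\psi_{i,*}\|_0)\mathbb{1}_{p^\nu_{j,i}\ne0}\bigr)$. - $\gamma^{(0)}_{p,q}$ is such that $\|\beta^{(0)}(u,v)\|_p\le\gamma^{(0)}_{p,q}\|u\|_q\|v\|_q$ for all $u,v$. - $f^{(0)}_{p,q}$ is such that the computed base case satisfies $\|\widehat{\beta^{(0)}}(u,v)-\beta^{(0)}(u,v)\|_p\le f^{(0)}_{p,q}\|u\|_q\|v\|_q\varepsilon+O(\varepsilon^2)$. **Floating point model.** A hat denotes a computed value. Every operation $\mathrm{op}\in\{+,-,\times,/\}$ returns $(a\,\mathrm{op}\,b)(1+\delta)$ with $|\delta|\le\varepsilon$. Linear combinations are computed coordinatewise as scalar products over the nonzero coefficients, in any order of summation. $O(\varepsilon^2)$ is for $\varepsilon\to0$, all other data being fixed (with constants uniform for inputs in bounded sets). *)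

theory Defs
  imports
    "Jordan_Normal_Form.Matrix"
    "HOL-Library.Multiset"
    "HOL-Library.Extended_Real"
    "HOL-Library.Landau_Symbols"
begin

section \<open>Norms\<close>

text \<open>The exponent \<open>p\<close> ranges over \<open>[1, \<infinity>]\<close>. The inserted \<open>0\<close> only matters for vectors of
  dimension 0.\<close>

definition lp_norm :: "ereal \<Rightarrow> real vec \<Rightarrow> real" where
  "lp_norm p x =
     (if p = \<infinity> then Max (insert 0 ((\<lambda>i. \<bar>x $ i\<bar>) ` {..<dim_vec x}))
      else (\<Sum>i<dim_vec x. \<bar>x $ i\<bar> powr real_of_ereal p) powr (1 / real_of_ereal p))"

definition lp_dual_norm :: "ereal \<Rightarrow> real vec \<Rightarrow> real" where
  "lp_dual_norm p x = (SUP y \<in> {y \<in> carrier_vec (dim_vec x). lp_norm p y \<le> 1}. x \<bullet> y)"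

definition mat_norm :: "ereal \<Rightarrow> real mat \<Rightarrow> real" where
  "mat_norm p A = lp_norm p (vec (dim_row A) (\<lambda>i. lp_dual_norm p (row A i)))"

definition nnz :: "real vec \<Rightarrow> nat" where
  "nnz x = card {i. i < dim_vec x \<and> x $ i \<noteq> 0}"

definition max_row_nnz :: "real mat \<Rightarrow> nat" where
  "max_row_nnz A = (MAX i\<in>{..<dim_row A}. nnz (row A i))"


section \<open>Bilinear maps\<close>

definition bilinear_map ::
    "nat \<Rightarrow> nat \<Rightarrow> nat \<Rightarrow> (real vec \<Rightarrow> real vec \<Rightarrow> real vec) \<Rightarrow> bool" where
  "bilinear_map e f g \<beta> \<longleftrightarrow>
     (\<forall>u\<in>carrier_vec e. \<forall>v\<in>carrier_vec f. \<beta> u v \<in> carrier_vec g) \<and>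
     (\<forall>u\<in>carrier_vec e. \<forall>u'\<in>carrier_vec e. \<forall>v\<in>carrier_vec f. \<beta> (u + u') v = \<beta> u v + \<beta> u' v) \<and>
     (\<forall>u\<in>carrier_vec e. \<forall>v\<in>carrier_vec f. \<forall>v'\<in>carrier_vec f. \<beta> u (v + v') = \<beta> u v + \<beta> u v') \<and>
     (\<forall>u\<in>carrier_vec e. \<forall>v\<in>carrier_vec f. \<forall>c. \<beta> (c \<cdot>\<^sub>v u) v = c \<cdot>\<^sub>v \<beta> u v \<and> \<beta> u (c \<cdot>\<^sub>v v) = c \<cdot>\<^sub>v \<beta> u v)"

text \<open>\<open>[L; R; P]\<close> represents \<open>\<beta>\<close>.\<close>

definition represents ::
    "real mat \<Rightarrow> real mat \<Rightarrow> real mat \<Rightarrow> (real vec \<Rightarrow> real vec \<Rightarrow> real vec) \<Rightarrow> bool" where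
  "represents L R P \<beta> \<longleftrightarrow>
     (\<forall>u\<in>carrier_vec (dim_col L). \<forall>v\<in>carrier_vec (dim_col R).
        \<beta> u v = vec (dim_row P) (\<lambda>j. \<Sum>i<dim_col P. P $$ (j, i) * (row L i \<bullet> u) * (row R i \<bullet> v)))"

text \<open>Matrices are identified with vectors by listing their entries row by row.\<close>

definition mat_of_vec :: "nat \<Rightarrow> nat \<Rightarrow> real vec \<Rightarrow> real mat" where
  "mat_of_vec m n u = mat m n (\<lambda>(i, j). u $ (i * n + j))"

definition vec_of_mat :: "real mat \<Rightarrow> real vec" where
  "vec_of_mat A = vec (dim_row A * dim_col A) (\<lambda>t. A $$ (t div dim_col A, t mod dim_col A))"

definition matmul_map :: "nat \<Rightarrow> nat \<Rightarrow> nat \<Rightarrow> real vec \<Rightarrow> real vec \<Rightarrow> real vec" where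
  "matmul_map m k n u v = vec_of_mat (mat_of_vec m k u * mat_of_vec k n v)"


section \<open>Block vectors and tensor powers\<close>

text \<open>\<open>block s u j\<close> is the \<open>j\<close>-th contiguous block of length \<open>s\<close> of \<open>u\<close>; \<open>glue s n xs\<close> concatenates
  \<open>n\<close> blocks of length \<open>s\<close>; \<open>lincomb s a xs\<close> is \<open>\<Sum>j. a\<^sub>j xs\<^sub>j\<close> for blocks \<open>xs\<^sub>j\<close> of length \<open>s\<close>.\<close>

definition block :: "nat \<Rightarrow> real vec \<Rightarrow> nat \<Rightarrow> real vec" where
  "block s u j = vec s (\<lambda>t. u $ (j * s + t))"

definition glue :: "nat \<Rightarrow> nat \<Rightarrow> (nat \<Rightarrow> real vec) \<Rightarrow> real vec" where
  "glue s n xs = vec (n * s) (\<lambda>t. xs (t div s) $ (t mod s))"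

definition lincomb :: "nat \<Rightarrow> real vec \<Rightarrow> (nat \<Rightarrow> real vec) \<Rightarrow> real vec" where
  "lincomb s a xs = vec s (\<lambda>t. \<Sum>j<dim_vec a. a $ j * xs j $ t)"

definition kronecker :: "real mat \<Rightarrow> real mat \<Rightarrow> real mat" where
  "kronecker A B = mat (dim_row A * dim_row B) (dim_col A * dim_col B)
     (\<lambda>(i, j). A $$ (i div dim_row B, j div dim_col B) * B $$ (i mod dim_row B, j mod dim_col B))"

primrec kronecker_power :: "real mat \<Rightarrow> nat \<Rightarrow> real mat" where
  "kronecker_power A 0 = 1\<^sub>m 1"
| "kronecker_power A (Suc l) = kronecker A (kronecker_power A l)"

text \<open>The tensor power acting on vectors whose leaves of length \<open>s\<close> are treated as scalars.\<close>

definition tensor_power :: "nat \<Rightarrow> real mat \<Rightarrow> nat \<Rightarrow> real mat" where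
  "tensor_power s A l = kronecker (kronecker_power A l) (1\<^sub>m s)"


section \<open>The exact algorithm\<close>

primrec beta_ab ::
    "(real vec \<Rightarrow> real vec \<Rightarrow> real vec) \<Rightarrow> nat \<Rightarrow> nat \<Rightarrow> nat \<Rightarrow>
     real mat \<Rightarrow> real mat \<Rightarrow> real mat \<Rightarrow> nat \<Rightarrow> real vec \<Rightarrow> real vec \<Rightarrow> real vec" where
  "beta_ab \<beta>0 e0 f0 g0 L R P 0 u v = \<beta>0 u v"
| "beta_ab \<beta>0 e0 f0 g0 L R P (Suc l) u v =
     (let se = e0 * dim_col L ^ l; sf = f0 * dim_col R ^ l; sg = g0 * dim_row P ^ l;
          ws = (\<lambda>i. beta_ab \<beta>0 e0 f0 g0 L R P l
                      (lincomb se (row L i) (block se u)) (lincomb sf (row R i) (block sf v)))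
      in glue sg (dim_row P) (\<lambda>j. lincomb sg (row P j) ws))"

definition beta_mmab ::
    "(real vec \<Rightarrow> real vec \<Rightarrow> real vec) \<Rightarrow> nat \<Rightarrow> nat \<Rightarrow> nat \<Rightarrow>
     real mat \<Rightarrow> real mat \<Rightarrow> real mat \<Rightarrow> real mat \<Rightarrow> real mat \<Rightarrow> real mat \<Rightarrow>
     nat \<Rightarrow> real vec \<Rightarrow> real vec \<Rightarrow> real vec" where
  "beta_mmab \<beta>0 e0 f0 g0 L R P \<phi> \<psi> \<nu> l u v =
     transpose_mat (tensor_power g0 \<nu> l) *\<^sub>v
       beta_ab \<beta>0 e0 f0 g0 L R P l (tensor_power e0 \<phi> l *\<^sub>v u) (tensor_power f0 \<psi> l *\<^sub>v v)"


section \<open>Floating point execution\<close>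

text \<open>Floating point computations are relations: the last argument is a value that the computation
  may return when every operation has relative error at most \<open>\<epsilon>\<close>. Subtracting a
  term computed with coefficient \<open>c\<close> has the same possible results as adding one computed with
  coefficient \<open>-c\<close>, so sums and products suffice.\<close>

definition fl_round :: "real \<Rightarrow> real \<Rightarrow> real \<Rightarrow> bool" where
  "fl_round \<epsilon> x y \<longleftrightarrow> (\<exists>\<delta>. \<bar>\<delta>\<bar> \<le> \<epsilon> \<and> y = x * (1 + \<delta>))"

text \<open>Sum of a multiset of already computed terms, in any order and with any parenthesization:
  \<open>n > 0\<close> terms take exactly \<open>n - 1\<close> additions.\<close>

inductive fl_sum :: "real \<Rightarrow> real multiset \<Rightarrow> real \<Rightarrow> bool" for \<epsilon> where
  fl_sum_empty: "fl_sum \<epsilon> {#} 0"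
| fl_sum_single: "fl_sum \<epsilon> {#x#} x"
| fl_sum_add: "M \<noteq> {#} \<Longrightarrow> N \<noteq> {#} \<Longrightarrow> fl_sum \<epsilon> M a \<Longrightarrow> fl_sum \<epsilon> N b \<Longrightarrow> fl_round \<epsilon> (a + b) c
    \<Longrightarrow> fl_sum \<epsilon> (M + N) c"

definition fl_scalar_prod :: "real \<Rightarrow> real vec \<Rightarrow> real vec \<Rightarrow> real \<Rightarrow> bool" where
  "fl_scalar_prod \<epsilon> a x y \<longleftrightarrow>
     (let J = {j. j < dim_vec a \<and> a $ j \<noteq> 0}
      in \<exists>c. (\<forall>j\<in>J. fl_round \<epsilon> (a $ j * x $ j) (c j)) \<and> fl_sum \<epsilon> (image_mset c (mset_set J)) y)"

definition fl_lincomb :: "real \<Rightarrow> nat \<Rightarrow> real vec \<Rightarrow> (nat \<Rightarrow> real vec) \<Rightarrow> real vec \<Rightarrow> bool" where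
  "fl_lincomb \<epsilon> s a xs y \<longleftrightarrow> y \<in> carrier_vec s \<and>
     (\<forall>t<s. fl_scalar_prod \<epsilon> a (vec (dim_vec a) (\<lambda>j. xs j $ t)) (y $ t))"

text \<open>Application of \<open>tensor_power s A l\<close>, one factor at a time: the outermost factor is applied
  either before or after the remaining ones (so both top-down and bottom-up orders are covered).\<close>

inductive fl_tensor_power ::
    "real \<Rightarrow> nat \<Rightarrow> real mat \<Rightarrow> nat \<Rightarrow> real vec \<Rightarrow> real vec \<Rightarrow> bool" for \<epsilon> s A where
  fl_tensor_power_0: "fl_tensor_power \<epsilon> s A 0 u u"
| fl_tensor_power_outer_first:
    "(\<And>i. i < dim_row A \<Longrightarrow>
        fl_lincomb \<epsilon> (s * dim_col A ^ l) (row A i) (block (s * dim_col A ^ l) u) (xs i)) \<Longrightarrow>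
     (\<And>i. i < dim_row A \<Longrightarrow> fl_tensor_power \<epsilon> s A l (xs i) (ys i)) \<Longrightarrow>
     fl_tensor_power \<epsilon> s A (Suc l) u (glue (s * dim_row A ^ l) (dim_row A) ys)"
| fl_tensor_power_outer_last:
    "(\<And>j. j < dim_col A \<Longrightarrow> fl_tensor_power \<epsilon> s A l (block (s * dim_col A ^ l) u j) (xs j)) \<Longrightarrow>
     (\<And>i. i < dim_row A \<Longrightarrow> fl_lincomb \<epsilon> (s * dim_row A ^ l) (row A i) xs (ys i)) \<Longrightarrow>
     fl_tensor_power \<epsilon> s A (Suc l) u (glue (s * dim_row A ^ l) (dim_row A) ys)"

text \<open>The base case is an arbitrary computation \<open>B\<close>, where \<open>B \<epsilon> u v w\<close> means that with machine
  precision \<open>\<epsilon>\<close> it may return \<open>w\<close> on input \<open>u, v\<close>. The recursive calls may round independently.\<close>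

type_synonym fl_map = "real \<Rightarrow> real vec \<Rightarrow> real vec \<Rightarrow> real vec \<Rightarrow> bool"

primrec fl_beta_ab ::
    "fl_map \<Rightarrow> nat \<Rightarrow> nat \<Rightarrow> nat \<Rightarrow> real mat \<Rightarrow> real mat \<Rightarrow> real mat \<Rightarrow> nat \<Rightarrow> fl_map" where
  "fl_beta_ab B e0 f0 g0 L R P 0 = B"
| "fl_beta_ab B e0 f0 g0 L R P (Suc l) = (\<lambda>\<epsilon> u v w.
     (let se = e0 * dim_col L ^ l; sf = f0 * dim_col R ^ l; sg = g0 * dim_row P ^ l
      in \<exists>us vs ws ys.
          (\<forall>i<dim_col P.
             fl_lincomb \<epsilon> se (row L i) (block se u) (us i) \<and>
             fl_lincomb \<epsilon> sf (row R i) (block sf v) (vs i) \<and>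
             fl_beta_ab B e0 f0 g0 L R P l \<epsilon> (us i) (vs i) (ws i)) \<and>
          (\<forall>j<dim_row P. fl_lincomb \<epsilon> sg (row P j) ws (ys j)) \<and>
          w = glue sg (dim_row P) ys))"

definition fl_beta_mmab ::
    "fl_map \<Rightarrow> nat \<Rightarrow> nat \<Rightarrow> nat \<Rightarrow> real mat \<Rightarrow> real mat \<Rightarrow> real mat \<Rightarrow>
     real mat \<Rightarrow> real mat \<Rightarrow> real mat \<Rightarrow> nat \<Rightarrow> fl_map" where
  "fl_beta_mmab B e0 f0 g0 L R P \<phi> \<psi> \<nu> l \<epsilon> u v w \<longleftrightarrow>
     (\<exists>u' v' w'. fl_tensor_power \<epsilon> e0 \<phi> l u u' \<and> fl_tensor_power \<epsilon> f0 \<psi> l v v' \<and>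
        fl_beta_ab B e0 f0 g0 L R P l \<epsilon> u' v' w' \<and>
        fl_tensor_power \<epsilon> g0 (transpose_mat \<nu>) l w' w)"

text \<open>A computation always returns some vector of the right dimension. (Without an actual value,
  the constant in \<open>fl_error_bound\<close> below could be negative.)\<close>

definition fl_computation :: "nat \<Rightarrow> nat \<Rightarrow> nat \<Rightarrow> fl_map \<Rightarrow> bool" where
  "fl_computation e f g B \<longleftrightarrow>
     (\<forall>\<epsilon>>0. \<forall>u\<in>carrier_vec e. \<forall>v\<in>carrier_vec f.
        (\<exists>w. B \<epsilon> u v w) \<and> (\<forall>w. B \<epsilon> u v w \<longrightarrow> w \<in> carrier_vec g))"

text \<open>All values returned by \<open>B\<close> satisfy \<open>\<parallel>w - \<beta>(u,v)\<parallel>\<^sub>p \<le> c \<parallel>u\<parallel>\<^sub>q \<parallel>v\<parallel>\<^sub>q \<epsilon> + O(\<epsilon>\<^sup>2)\<close> as \<open>\<epsilon> \<rightarrow> 0\<close>, the \<open>O\<close>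
  being uniform for \<open>u, v\<close> in bounded sets.\<close>

definition fl_error_bound ::
    "ereal \<Rightarrow> ereal \<Rightarrow> nat \<Rightarrow> nat \<Rightarrow> (real vec \<Rightarrow> real vec \<Rightarrow> real vec) \<Rightarrow> fl_map \<Rightarrow> real \<Rightarrow> bool" where
  "fl_error_bound p q e f \<beta> B c \<longleftrightarrow>
     (\<forall>K. \<exists>h \<in> O[at_right 0](\<lambda>\<epsilon>. \<epsilon>\<^sup>2). \<forall>\<^sub>F \<epsilon> in at_right (0::real).
        \<forall>u\<in>carrier_vec e. \<forall>v\<in>carrier_vec f. lp_norm q u \<le> K \<longrightarrow> lp_norm q v \<le> K \<longrightarrow>
          (\<forall>w. B \<epsilon> u v w \<longrightarrow>
             lp_norm p (w - \<beta> u v) \<le> c * lp_norm q u * lp_norm q v * \<epsilon> + h \<epsilon>))"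


section \<open>Constants\<close>

definition gamma_ab :: "ereal \<Rightarrow> ereal \<Rightarrow> real mat \<Rightarrow> real mat \<Rightarrow> real mat \<Rightarrow> real" where
  "gamma_ab p q L R P = lp_norm p (vec (dim_row P)
     (\<lambda>j. \<Sum>i<dim_col P. lp_dual_norm q (row L i) * lp_dual_norm q (row R i) * \<bar>P $$ (j, i)\<bar>))"

definition gamma_mmab ::
    "ereal \<Rightarrow> ereal \<Rightarrow> real mat \<Rightarrow> real mat \<Rightarrow> real mat \<Rightarrow>
     real mat \<Rightarrow> real mat \<Rightarrow> real mat \<Rightarrow> real" where
  "gamma_mmab p q L R P \<phi> \<psi> \<nu> =
     gamma_ab p q L R P * mat_norm q \<phi> * mat_norm q \<psi> * mat_norm p (transpose_mat \<nu>)"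

definition Q_ab :: "real mat \<Rightarrow> real mat \<Rightarrow> real mat \<Rightarrow> nat" where
  "Q_ab L R P = (MAX j\<in>{..<dim_row P}. nnz (row P j) +
     (MAX i\<in>{..<dim_col P}. (nnz (row L i) + nnz (row R i)) * of_bool (P $$ (j, i) \<noteq> 0)))"

end

theory Submission
  imports Defs "HOL-Analysis.Convex"
begin

text \<open>The analysis is exact in \<open>\<epsilon>\<close> until the very end. Suppose that every quantity \<open>x\<close> of the
  algorithm comes with a bound \<open>\<parallel>x\<parallel> \<le> M\<close> and that its computed version has error at most \<open>H - M\<close>.
  A linear combination with \<open>k\<close> nonzero coefficients performs at most \<open>k\<close> roundings on any path
  from an input to the output, so it turns \<open>H\<close> into \<open>(1 + \<epsilon>)\<^sup>k H\<close>, while \<open>M\<close> and \<open>H\<close> are both multiplied by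
  the operator norm bound of the exact combination (\<open>fl_lincomb_propagation\<close>). A bilinear map multiplies the
  amplification factors of its two arguments (\<open>bilinear_propagation\<close>). The ratio \<open>H / M\<close> thus simply
  collects one factor \<open>1 + \<epsilon>\<close> per rounding along the most expensive path: per level,
  \<open>Q\<^sub>0\<close> factors in the sparsified recursion, since a row \<open>j\<close> of \<open>P\<close> meets a product \<open>i\<close> only if
  \<open>P\<^sub>j\<^sub>i \<noteq> 0\<close>, and \<open>Q\<^sub>\<phi>\<close>, \<open>Q\<^sub>\<psi>\<close>, \<open>Q\<^sub>\<nu>\<close> factors in the changes of basis.

  The operator norm bounds come from cutting vectors into blocks: the norm of a vector is the norm of the
  vector of norms of its blocks (\<open>lp_norm_glue\<close>), and a combination of blocks with coefficient vector \<open>a\<close>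
  costs a factor \<open>\<parallel>a\<parallel>\<^sub>q\<^sub>*\<close> by duality. This gives \<open>\<parallel>\<phi>\<parallel>\<close>, \<open>\<parallel>\<psi>\<parallel>\<close>, \<open>\<parallel>\<nu>\<^sup>T\<parallel>\<close> and \<open>\<gamma>\<^sub>a\<^sub>b\<close> per level.

  Relative to \<open>\<parallel>u\<parallel> \<parallel>v\<parallel>\<close>, the base case has \<open>M = \<gamma>\<^sub>0\<close> and \<open>H = \<gamma>\<^sub>0 + c\<^sub>0 \<epsilon>\<close>. With \<open>\<Gamma>\<close> the \<open>l\<close>-th power of
  \<open>gamma_mmab\<close>, the total error is therefore at most \<open>\<Gamma> ((1 + \<epsilon>)\<^sup>N (\<gamma>\<^sub>0 + c\<^sub>0 \<epsilon>) - \<gamma>\<^sub>0) \<parallel>u\<parallel> \<parallel>v\<parallel>\<close> with \<open>N = l (Q\<^sub>0 + Q\<^sub>\<phi> + Q\<^sub>\<psi> + Q\<^sub>\<nu>)\<close>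
  (\<open>fl_beta_mmab_error\<close>), whose part of first order is the claimed bound. The \<open>O(\<epsilon>\<^sup>2)\<close> of the base case is
  an additive term \<open>\<eta>\<close> that is not proportional to the inputs; it is carried along separately and stays
  \<open>O(\<epsilon>\<^sup>2)\<close>, because for \<open>\<epsilon> \<le> 1\<close> all intermediate vectors stay in a bounded set.\<close>


section \<open>The \<open>\<ell>\<^sub>p\<close> norms and their duals\<close>

lemma exponent_cases:
  assumes "1 \<le> (p::ereal)"
  obtains "p = \<infinity>" | r where "1 \<le> r" and "p = ereal r"
  using assms by (cases p) (auto simp: one_ereal_def)

lemma lp_norm_ereal:
  "lp_norm (ereal r) x = (\<Sum>i<dim_vec x. \<bar>x $ i\<bar> powr r) powr (1 / r)"
  by (simp add: lp_norm_def)

lemma lp_norm_powr: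
  assumes "1 \<le> r"
  shows "lp_norm (ereal r) x powr r = (\<Sum>i<dim_vec x. \<bar>x $ i\<bar> powr r)"
  using assms by (simp add: lp_norm_ereal powr_powr sum_nonneg)

lemma lp_norm_infty_le_iff:
  "0 \<le> c \<Longrightarrow> lp_norm \<infinity> x \<le> c \<longleftrightarrow> (\<forall>i<dim_vec x. \<bar>x $ i\<bar> \<le> c)"
  by (auto simp: lp_norm_def)

lemma lp_norm_nonneg [simp]: "0 \<le> lp_norm p x"
  by (simp add: lp_norm_def)

lemma component_le_lp_norm:
  assumes "1 \<le> p" and i: "i < dim_vec x"
  shows "\<bar>x $ i\<bar> \<le> lp_norm p x"
  using assms(1)
proof (cases rule: exponent_cases)
  case 1
  then show ?thesis
    using i lp_norm_infty_le_iff[of "lp_norm \<infinity> x" x] by simp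
next
  case (2 r)
  have "\<bar>x $ i\<bar> powr r \<le> lp_norm p x powr r"
    unfolding 2 lp_norm_powr[OF 2(1)] using i by (intro member_le_sum) auto
  then show ?thesis
    using powr_less_mono2[of r "lp_norm p x" "\<bar>x $ i\<bar>"] 2(1) by force
qed

lemma lp_norm_ones_pos:
  assumes "1 \<le> q" "0 < n"
  shows "0 < lp_norm q (vec n (\<lambda>_. 1))"
  using component_le_lp_norm[OF assms(1), of 0 "vec n (\<lambda>_. 1)"] assms(2) by simp

lemma lp_norm_mono:
  assumes p: "1 \<le> p" and d: "dim_vec x = dim_vec y"
    and le: "\<And>i. i < dim_vec x \<Longrightarrow> \<bar>x $ i\<bar> \<le> \<bar>y $ i\<bar>"
  shows "lp_norm p x \<le> lp_norm p y"
  using p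
proof (cases rule: exponent_cases)
  case 1
  then show ?thesis
    using le d component_le_lp_norm[of \<infinity> _ y]
    by (simp add: lp_norm_infty_le_iff) (meson order_trans)
next
  case (2 r)
  then show ?thesis
    unfolding 2 lp_norm_ereal d using le d
    by (intro powr_mono2 sum_mono sum_nonneg) auto
qed

lemma lp_norm_smult:
  assumes p: "1 \<le> p"
  shows "lp_norm p (vec n (\<lambda>i. c * f i)) = \<bar>c\<bar> * lp_norm p (vec n f)"
  using p
proof (cases rule: exponent_cases)
  case 1
  show ?thesis
  proof (cases "c = 0")
    case True
    then show ?thesis
      unfolding 1 by (intro antisym) (simp_all add: lp_norm_infty_le_iff)
  next
    case False
    have *: "lp_norm \<infinity> (vec n (\<lambda>i. c * f i)) \<le> \<bar>c\<bar> * lp_norm \<infinity> (vec n f)" for c f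
      using component_le_lp_norm[of \<infinity> _ "vec n f"]
      by (subst lp_norm_infty_le_iff) (auto simp: abs_mult intro!: mult_left_mono)
    have "\<bar>c\<bar> * lp_norm \<infinity> (vec n f) \<le> lp_norm \<infinity> (vec n (\<lambda>i. c * f i))"
      using *[of "1 / c" "\<lambda>i. c * f i"] False by (simp add: field_simps)
    with * 1 show ?thesis by (simp add: antisym)
  qed
next
  case (2 r)
  have "(\<Sum>i<n. \<bar>c * f i\<bar> powr r) = \<bar>c\<bar> powr r * (\<Sum>i<n. \<bar>f i\<bar> powr r)"
    by (simp add: abs_mult powr_mult sum_distrib_left)
  then show ?thesis
    using 2 by (simp add: lp_norm_ereal powr_mult sum_nonneg powr_powr)
qed

text \<open>Convexity of \<open>x\<^sup>r\<close> extended from the open to the closed half-line, so that vanishing entries need no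
  special treatment in Minkowski's inequality.\<close>

lemma powr_convex_nonneg:
  fixes a b s t r :: real
  assumes r: "1 \<le> r" and nn: "0 \<le> a" "0 \<le> b" "0 \<le> s" "0 \<le> t" and st: "s + t = 1"
  shows "(s * a + t * b) powr r \<le> s * a powr r + t * b powr r"
proof -
  have scale: "(s * a) powr r \<le> s * a powr r" if "0 \<le> s" "s \<le> 1" "0 \<le> a" for s a :: real
  proof (cases "s = 0")
    case False
    then have "s powr r \<le> s powr 1"
      using that r by (intro powr_mono') auto
    with False that show ?thesis by (simp add: powr_mult mult_right_mono)
  qed simp
  show ?thesis
  proof (cases "a = 0 \<or> b = 0")
    case True
    then show ?thesis using scale[of s a] scale[of t b] nn st r by auto
  next
    case False
    have "s = 1 - t" using st by simp
    with False show ?thesis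
      using convex_onD[OF powr_convex[OF r], of t a b] nn by simp
  qed
qed

text \<open>Minkowski's inequality, by convexity after normalizing both vectors: \<open>f + g\<close> is \<open>a + b\<close> times the convex
  combination of \<open>f / a\<close> and \<open>g / b\<close> with weights \<open>a / (a + b)\<close> and \<open>b / (a + b)\<close>, where \<open>a\<close> and \<open>b\<close> are the
  two norms.\<close>

lemma lp_norm_triangle:
  assumes p: "1 \<le> p"
  shows "lp_norm p (vec n (\<lambda>i. f i + g i)) \<le> lp_norm p (vec n f) + lp_norm p (vec n g)"
  using p
proof (cases rule: exponent_cases)
  case 1
  have "\<bar>f i + g i\<bar> \<le> lp_norm \<infinity> (vec n f) + lp_norm \<infinity> (vec n g)" if "i < n" for i
    using component_le_lp_norm[of \<infinity> i "vec n f"] component_le_lp_norm[of \<infinity> i "vec n g"] that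
    by simp
  then show ?thesis
    unfolding 1 by (subst lp_norm_infty_le_iff) auto
next
  case (2 r)
  define a b where "a = lp_norm p (vec n f)" and "b = lp_norm p (vec n g)"
  have zero: "f i = 0" if "lp_norm p (vec n f) = 0" "i < n" for f :: "nat \<Rightarrow> real" and i
    using component_le_lp_norm[OF p, of i "vec n f"] that by simp
  consider "a = 0" | "b = 0" | "0 < a" "0 < b"
    unfolding a_def b_def by (metis lp_norm_nonneg order_le_less)
  then show ?thesis
  proof cases
    case 1
    then have "lp_norm p (vec n (\<lambda>i. f i + g i)) \<le> b"
      using zero[of f] unfolding a_def b_def by (intro lp_norm_mono p) auto
    then show ?thesis unfolding b_def using lp_norm_nonneg[of p "vec n f"] by linarith
  next
    case 2
    then have "lp_norm p (vec n (\<lambda>i. f i + g i)) \<le> a"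
      using zero[of g] unfolding a_def b_def by (intro lp_norm_mono p) auto
    then show ?thesis unfolding a_def using lp_norm_nonneg[of p "vec n g"] by linarith
  next
    case 3
    define s where "s = a + b"
    have s: "0 < s" using 3 by (simp add: s_def)
    have one: "(\<Sum>i<n. (\<bar>f i\<bar> / lp_norm p (vec n f)) powr r) = 1"
      if "0 < lp_norm p (vec n f)" for f :: "nat \<Rightarrow> real"
      using lp_norm_powr[OF 2(1), of "vec n f"] that powr_gt_zero[of "lp_norm p (vec n f)" r]
      by (simp del: powr_gt_zero add: powr_divide 2(2) flip: sum_divide_distrib)
    have "\<bar>f i + g i\<bar> powr r
        \<le> s powr r * (a / s * (\<bar>f i\<bar> / a) powr r + b / s * (\<bar>g i\<bar> / b) powr r)" for i
    proof -
      have "\<bar>f i + g i\<bar> \<le> s * (a / s * (\<bar>f i\<bar> / a) + b / s * (\<bar>g i\<bar> / b))"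
        using 3 s abs_triangle_ineq[of "f i" "g i"] by (simp add: distrib_left)
      then have "\<bar>f i + g i\<bar> powr r \<le> (s * (a / s * (\<bar>f i\<bar> / a) + b / s * (\<bar>g i\<bar> / b))) powr r"
        using 2(1) by (intro powr_mono2) auto
      also have "\<dots> = s powr r * (a / s * (\<bar>f i\<bar> / a) + b / s * (\<bar>g i\<bar> / b)) powr r"
        by (rule powr_mult)
      also have "\<dots> \<le> s powr r * (a / s * (\<bar>f i\<bar> / a) powr r + b / s * (\<bar>g i\<bar> / b) powr r)"
        using 2(1) 3 s
        by (intro mult_left_mono powr_convex_nonneg) (auto simp: s_def simp flip: add_divide_distrib)
      finally show ?thesis .
    qed
    then have "(\<Sum>i<n. \<bar>f i + g i\<bar> powr r)
        \<le> (\<Sum>i<n. s powr r * (a / s * (\<bar>f i\<bar> / a) powr r + b / s * (\<bar>g i\<bar> / b) powr r))"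
      by (rule sum_mono)
    also have "\<dots> = s powr r * (a / s * (\<Sum>i<n. (\<bar>f i\<bar> / a) powr r)
        + b / s * (\<Sum>i<n. (\<bar>g i\<bar> / b) powr r))"
      by (simp add: sum.distrib distrib_left sum_distrib_left)
    also have "\<dots> = s powr r"
      using one[of f] one[of g] 3 s
      by (simp add: a_def[symmetric] b_def[symmetric] s_def flip: add_divide_distrib)
    finally have "(\<Sum>i<n. \<bar>f i + g i\<bar> powr r) powr (1 / r) \<le> (s powr r) powr (1 / r)"
      using 2(1) by (intro powr_mono2 sum_nonneg) auto
    then show ?thesis
      using 2 s by (simp add: lp_norm_ereal powr_powr s_def a_def b_def)
  qed
qed

lemma lp_norm_zero_fun: "1 \<le> p \<Longrightarrow> lp_norm p (vec n (\<lambda>i. 0)) = 0"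
  using lp_norm_smult[of p n 0 "\<lambda>i. 0"] by simp

lemma lp_norm_sum_le:
  assumes p: "1 \<le> p"
  shows "lp_norm p (vec n (\<lambda>t. \<Sum>j\<in>J. f j t)) \<le> (\<Sum>j\<in>J. lp_norm p (vec n (f j)))"
proof (induction J rule: infinite_finite_induct)
  case (insert j J)
  then show ?case
    using lp_norm_triangle[OF p, of n "f j" "\<lambda>t. \<Sum>j\<in>J. f j t"] by simp
qed (simp_all add: lp_norm_zero_fun p)

lemma lp_norm_add_le:
  assumes p: "1 \<le> p" and "x \<in> carrier_vec n" "y \<in> carrier_vec n"
  shows "lp_norm p (x + y) \<le> lp_norm p x + lp_norm p y"
proof -
  have "x + y = vec n (\<lambda>i. x $ i + y $ i)" "x = vec n (\<lambda>i. x $ i)" "y = vec n (\<lambda>i. y $ i)"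
    using assms by (auto intro!: eq_vecI)
  then show ?thesis using lp_norm_triangle[OF p, of n "\<lambda>i. x $ i" "\<lambda>i. y $ i"] by metis
qed

lemma lp_norm_via_diff:
  assumes "1 \<le> p" and "x \<in> carrier_vec n" "y \<in> carrier_vec n"
  shows "lp_norm p x \<le> lp_norm p (x - y) + lp_norm p y"
proof -
  have "x = (x - y) + y" using assms by (auto intro!: eq_vecI)
  then show ?thesis using lp_norm_add_le[of p "x - y" n y] assms by auto
qed

lemma lp_norm_diff_triangle:
  assumes "1 \<le> p" and "x \<in> carrier_vec n" "y \<in> carrier_vec n" "z \<in> carrier_vec n"
  shows "lp_norm p (x - z) \<le> lp_norm p (x - y) + lp_norm p (y - z)"
proof -
  have "x - z = (x - y) + (y - z)" using assms by (auto intro!: eq_vecI)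
  then show ?thesis using lp_norm_add_le[of p "x - y" n "y - z"] assms by auto
qed

text \<open>Hoelder's inequality in the form in which it is used: the weights \<open>y\<close> will be norms of blocks. It is
  the definition of the dual norm applied to \<open>y\<close> with the signs of \<open>a\<close>, scaled to the unit ball.\<close>

lemma dual_pairing_le:
  assumes p: "1 \<le> p" and y: "\<And>j. j < dim_vec a \<Longrightarrow> 0 \<le> y j"
  shows "(\<Sum>j<dim_vec a. \<bar>a $ j\<bar> * y j) \<le> lp_dual_norm p a * lp_norm p (vec (dim_vec a) y)"
    (is "?S \<le> _ * ?N")
proof -
  let ?n = "dim_vec a"
  have bdd: "bdd_above ((\<lambda>y. scalar_prod a y) ` {y \<in> carrier_vec ?n. lp_norm p y \<le> 1})"
  proof (rule bdd_aboveI2[where M = "\<Sum>j<?n. \<bar>a $ j\<bar>"])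
    fix y :: "real vec" assume y: "y \<in> {y \<in> carrier_vec ?n. lp_norm p y \<le> 1}"
    have "a $ j * y $ j \<le> \<bar>a $ j\<bar>" if "j < ?n" for j
    proof -
      have "\<bar>y $ j\<bar> \<le> 1" using component_le_lp_norm[OF p, of j y] y that by auto
      then have "\<bar>a $ j\<bar> * \<bar>y $ j\<bar> \<le> \<bar>a $ j\<bar> * 1" by (intro mult_left_mono) auto
      then show ?thesis by (simp add: abs_mult[symmetric] abs_le_iff)
    qed
    then show "scalar_prod a y \<le> (\<Sum>j<?n. \<bar>a $ j\<bar>)"
      using y by (auto simp: scalar_prod_def atLeast0LessThan carrier_vecD intro!: sum_mono)
  qed
  show ?thesis
  proof (cases "?N = 0")
    case True
    then have "y j = 0" if "j < ?n" for j
      using component_le_lp_norm[OF p, of j "vec ?n y"] that by simp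
    then show ?thesis using True by simp
  next
    case False
    then have N: "0 < ?N" by (simp add: order_less_le)
    \<comment> \<open>the maximizing direction: \<open>y\<close> with the signs of \<open>a\<close>\<close>
    let ?z = "vec ?n (\<lambda>j. sgn (a $ j) * y j / ?N)"
    have "lp_norm p ?z \<le> lp_norm p (vec ?n (\<lambda>j. (1 / ?N) * y j))"
      using N by (intro lp_norm_mono p) (auto simp: abs_mult abs_sgn_eq divide_right_mono)
    also have "\<dots> = 1" using N by (subst lp_norm_smult[OF p]) simp
    finally have "scalar_prod a ?z \<le> lp_dual_norm p a"
      unfolding lp_dual_norm_def by (intro cSUP_upper bdd) auto
    moreover have "scalar_prod a ?z = ?S / ?N"
      by (simp add: scalar_prod_def atLeast0LessThan sum_divide_distrib abs_sgn mult_ac)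
    ultimately have "?S / ?N \<le> lp_dual_norm p a" by simp
    then show ?thesis using N by (simp add: pos_divide_le_eq)
  qed
qed

lemma lp_dual_norm_nonneg:
  assumes p: "1 \<le> p"
  shows "0 \<le> lp_dual_norm p a"
proof (cases "dim_vec a = 0")
  case True
  then have "scalar_prod a y = 0" if "y \<in> carrier_vec (dim_vec a)" for y
    using that by (simp add: scalar_prod_def)
  moreover have "lp_norm p (vec 0 (\<lambda>_. 0)) \<le> 1" using lp_norm_zero_fun[OF p, of 0] by simp
  then have "{y \<in> carrier_vec (dim_vec a). lp_norm p y \<le> 1} \<noteq> {}"
    using True by (metis (mono_tags, lifting) empty_Collect_eq vec_carrier)
  ultimately show ?thesis unfolding lp_dual_norm_def by simp
next
  case False
  let ?N = "lp_norm p (vec (dim_vec a) (\<lambda>_. 1))"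
  have "0 < ?N"
    using component_le_lp_norm[OF p, of 0 "vec (dim_vec a) (\<lambda>_. 1)"] False by simp
  moreover have "0 \<le> (\<Sum>j<dim_vec a. \<bar>a $ j\<bar> * 1)" by (simp add: sum_nonneg)
  then have "0 \<le> lp_dual_norm p a * ?N"
    using dual_pairing_le[OF p, of a "\<lambda>_. 1"] by linarith
  ultimately show ?thesis by (simp add: zero_le_mult_iff)
qed


section \<open>Vectors of blocks\<close>

lemma index_div_mod:
  fixes t :: nat
  assumes "t < n * s" shows "t div s < n" "t mod s < s"
  using assms by (auto simp: less_mult_imp_div_less intro!: mod_less_divisor gr0I)

lemma block_index_less:
  fixes i :: nat
  assumes "i < n" "k < s" shows "i * s + k < n * s"
proof -
  have "i * s + k < Suc i * s" using assms by simp
  also have "\<dots> \<le> n * s" using assms by (intro mult_right_mono) auto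
  finally show ?thesis .
qed

lemma sum_blocks:
  fixes h :: "nat \<Rightarrow> 'a::comm_monoid_add"
  shows "(\<Sum>t<n * s. h t) = (\<Sum>i<n. \<Sum>k<s. h (i * s + k))"
proof -
  have "(\<Sum>t<n * s. h t) = (\<Sum>i<n. \<Sum>t\<in>{i * s..<i * s + s}. h t)"
    by (simp add: sum.nat_group)
  also have "\<dots> = (\<Sum>i<n. \<Sum>k<s. h (i * s + k))"
    by (simp add: sum.atLeastLessThan_shift_0[of _ "_ * s"] atLeast0LessThan add.commute)
  finally show ?thesis .
qed

text \<open>Taking norms of blocks first and then the norm of the result loses nothing. This makes all estimates
  for block vectors recursive.\<close>

lemma lp_norm_glue:
  assumes p: "1 \<le> p" and xs: "\<And>i. i < n \<Longrightarrow> xs i \<in> carrier_vec s"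
  shows "lp_norm p (glue s n xs) = lp_norm p (vec n (\<lambda>i. lp_norm p (xs i)))"
proof -
  show ?thesis
    using p
  proof (cases rule: exponent_cases)
    case 1
    show ?thesis
    proof (rule antisym)
      have "\<bar>xs (t div s) $ (t mod s)\<bar> \<le> lp_norm p (vec n (\<lambda>i. lp_norm p (xs i)))"
        if t: "t < n * s" for t
      proof -
        note i = index_div_mod[OF t]
        have "\<bar>xs (t div s) $ (t mod s)\<bar> \<le> lp_norm p (xs (t div s))"
          using component_le_lp_norm[OF p, of "t mod s" "xs (t div s)"] i xs[OF i(1)]
          by (simp add: carrier_vecD)
        also have "\<dots> \<le> lp_norm p (vec n (\<lambda>i. lp_norm p (xs i)))"
          using component_le_lp_norm[OF p, of "t div s" "vec n (\<lambda>i. lp_norm p (xs i))"] i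
          by simp
        finally show ?thesis .
      qed
      then show "lp_norm p (glue s n xs) \<le> lp_norm p (vec n (\<lambda>i. lp_norm p (xs i)))"
        unfolding 1 by (subst lp_norm_infty_le_iff) (simp_all add: glue_def)
      have "\<bar>xs i $ k\<bar> \<le> lp_norm p (glue s n xs)" if "i < n" "k < s" for i k
        using component_le_lp_norm[OF p, of "i * s + k" "glue s n xs"] block_index_less[OF that] that
        by (simp add: glue_def)
      then show "lp_norm p (vec n (\<lambda>i. lp_norm p (xs i))) \<le> lp_norm p (glue s n xs)"
        unfolding 1 using carrier_vecD[OF xs] by (simp add: lp_norm_infty_le_iff)
    qed
  next
    case (2 r)
    have "(\<Sum>t<n * s. \<bar>xs (t div s) $ (t mod s)\<bar> powr r)
        = (\<Sum>i<n. \<Sum>k<s. \<bar>xs i $ k\<bar> powr r)"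
      by (simp add: sum_blocks)
    also have "\<dots> = (\<Sum>i<n. lp_norm p (xs i) powr r)"
      using carrier_vecD[OF xs] unfolding 2(2) lp_norm_powr[OF 2(1)] by (intro sum.cong) auto
    finally show ?thesis
      unfolding 2(2) lp_norm_ereal by (simp add: glue_def)
  qed
qed

lemma glue_carrier [simp]: "glue s n xs \<in> carrier_vec (n * s)"
  by (simp add: glue_def)

lemma block_carrier [simp]: "block s u j \<in> carrier_vec s"
  by (simp add: block_def)

lemma lincomb_carrier [simp]: "lincomb s a xs \<in> carrier_vec s"
  by (simp add: lincomb_def)

lemma glue_block: "u \<in> carrier_vec (n * s) \<Longrightarrow> glue s n (block s u) = u"
  using index_div_mod by (auto simp: glue_def block_def intro!: eq_vecI)

lemma glue_diff:
  assumes "\<And>i. i < n \<Longrightarrow> xs i \<in> carrier_vec s" "\<And>i. i < n \<Longrightarrow> ys i \<in> carrier_vec s"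
  shows "glue s n xs - glue s n ys = glue s n (\<lambda>i. xs i - ys i)"
  using assms index_div_mod by (auto simp: glue_def intro!: eq_vecI) (metis carrier_vecD index_minus_vec(1))

lemma lincomb_diff:
  assumes "\<And>j. j < dim_vec a \<Longrightarrow> xs j \<in> carrier_vec s" "\<And>j. j < dim_vec a \<Longrightarrow> ys j \<in> carrier_vec s"
  shows "lincomb s a xs - lincomb s a ys = lincomb s a (\<lambda>j. xs j - ys j)"
proof (rule eq_vecI)
  fix t assume "t < dim_vec (lincomb s a (\<lambda>j. xs j - ys j))"
  then show "(lincomb s a xs - lincomb s a ys) $ t = lincomb s a (\<lambda>j. xs j - ys j) $ t"
    using carrier_vecD[OF assms(1)] carrier_vecD[OF assms(2)]
    by (simp add: lincomb_def sum_subtractf[symmetric] right_diff_distrib[symmetric])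
qed (simp add: lincomb_def)

lemma lp_norm_glue_le:
  assumes p: "1 \<le> p" and xs: "\<And>i. i < n \<Longrightarrow> xs i \<in> carrier_vec s"
    and le: "\<And>i. i < n \<Longrightarrow> lp_norm p (xs i) \<le> b i"
  shows "lp_norm p (glue s n xs) \<le> lp_norm p (vec n b)"
proof -
  have "lp_norm p (vec n (\<lambda>i. lp_norm p (xs i))) \<le> lp_norm p (vec n b)"
    using le by (intro lp_norm_mono p) (auto intro: order_trans[OF _ abs_ge_self])
  then show ?thesis using lp_norm_glue[OF p xs] by simp
qed

lemma lp_norm_blocks:
  assumes "1 \<le> p" and "u \<in> carrier_vec (n * s)"
  shows "lp_norm p (vec n (\<lambda>j. lp_norm p (block s u j))) = lp_norm p u"
  using lp_norm_glue[of p n "block s u" s] glue_block[of u n s] assms by simp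

lemma lp_norm_lincomb_le:
  assumes p: "1 \<le> p" and xs: "\<And>j. j < dim_vec a \<Longrightarrow> xs j \<in> carrier_vec s"
  shows "lp_norm p (lincomb s a xs) \<le> (\<Sum>j<dim_vec a. \<bar>a $ j\<bar> * lp_norm p (xs j))"
proof -
  have "lp_norm p (lincomb s a xs) \<le> (\<Sum>j<dim_vec a. lp_norm p (vec s (\<lambda>t. a $ j * xs j $ t)))"
    unfolding lincomb_def by (rule lp_norm_sum_le[OF p])
  also have "\<dots> = (\<Sum>j<dim_vec a. \<bar>a $ j\<bar> * lp_norm p (xs j))"
  proof (intro sum.cong refl)
    fix j assume "j \<in> {..<dim_vec a}"
    then have "vec s (\<lambda>t. xs j $ t) = xs j" using carrier_vecD[OF xs] by (auto intro!: eq_vecI)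
    then show "lp_norm p (vec s (\<lambda>t. a $ j * xs j $ t)) = \<bar>a $ j\<bar> * lp_norm p (xs j)"
      by (simp add: lp_norm_smult[OF p])
  qed
  finally show ?thesis .
qed

text \<open>The norm bound for one output block of a linear map that acts on blocks.\<close>

lemma weighted_block_norms_le:
  assumes "1 \<le> p" and "u \<in> carrier_vec (dim_vec a * s)"
  shows "(\<Sum>j<dim_vec a. \<bar>a $ j\<bar> * lp_norm p (block s u j)) \<le> lp_dual_norm p a * lp_norm p u"
  using dual_pairing_le[of p a "\<lambda>j. lp_norm p (block s u j)"] lp_norm_blocks[OF assms] assms by simp


section \<open>Rounding errors of linear combinations\<close>

text \<open>Whatever the parenthesization of \<open>n\<close> terms, each of them takes part in at most \<open>n - 1\<close> additions: both
  operands of the last addition have fewer terms, hence errors of at most \<open>(1 + \<epsilon>)\<^sup>k - 1\<close> with \<open>k = n - 2\<close>,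
  relative to the absolute values of their terms, and rounding their sum raises the exponent by one.\<close>

lemma fl_sum_error:
  assumes eps: "0 \<le> \<epsilon>" and "fl_sum \<epsilon> M y"
  shows "\<bar>y - sum_mset M\<bar> \<le> ((1 + \<epsilon>) ^ (size M - 1) - 1) * (\<Sum>x\<in>#M. \<bar>x\<bar>)"
  using assms(2)
proof induction
  case (fl_sum_add M N a b c)
  let ?S = "sum_mset M + sum_mset N" and ?T = "(\<Sum>x\<in>#M. \<bar>x\<bar>) + (\<Sum>x\<in>#N. \<bar>x\<bar>)"
  define k where "k = size M + size N - 2"
  have size: "size M \<noteq> 0" "size N \<noteq> 0" using fl_sum_add.hyps by auto
  have T0: "0 \<le> (\<Sum>x\<in>#M. \<bar>x\<bar>)" for M :: "real multiset"
    by (induction M) auto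
  have S: "\<bar>sum_mset M\<bar> \<le> (\<Sum>x\<in>#M. \<bar>x\<bar>)" for M :: "real multiset"
    by (induction M) (auto intro: order_trans[OF abs_triangle_ineq])
  have le: "((1 + \<epsilon>) ^ (size M' - 1) - 1) * (\<Sum>x\<in>#M'. \<bar>x\<bar>) \<le> ((1 + \<epsilon>) ^ k - 1) * (\<Sum>x\<in>#M'. \<bar>x\<bar>)"
    if "M' \<in> {M, N}" for M'
    using that size eps
    by (intro mult_right_mono T0 diff_right_mono power_increasing)
      (auto simp: k_def simp del: size_eq_0_iff_empty)
  have ab: "\<bar>a + b - ?S\<bar> \<le> ((1 + \<epsilon>) ^ k - 1) * ?T"
    using fl_sum_add.IH le[of M] le[of N] by (simp add: distrib_left)
  obtain \<delta> where \<delta>: "\<bar>\<delta>\<bar> \<le> \<epsilon>" "c = (a + b) * (1 + \<delta>)"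
    using fl_sum_add.hyps by (auto simp: fl_round_def)
  have "\<bar>c - ?S\<bar> = \<bar>(a + b - ?S) * (1 + \<delta>) + ?S * \<delta>\<bar>"
    by (simp add: \<delta> algebra_simps)
  also have "\<dots> \<le> \<bar>a + b - ?S\<bar> * \<bar>1 + \<delta>\<bar> + \<bar>?S\<bar> * \<bar>\<delta>\<bar>"
    by (metis abs_mult abs_triangle_ineq)
  also have "\<dots> \<le> ((1 + \<epsilon>) ^ k - 1) * ?T * (1 + \<epsilon>) + ?T * \<epsilon>"
    using ab \<delta> eps S[of M] S[of N] T0[of M] T0[of N]
    by (intro add_mono mult_mono) (auto intro!: mult_nonneg_nonneg)
  also have "\<dots> = ((1 + \<epsilon>) ^ Suc k - 1) * ?T"
  proof -
    have "((1 + \<epsilon>) ^ k - 1) * T * (1 + \<epsilon>) + T * \<epsilon> = ((1 + \<epsilon>) ^ Suc k - 1) * T" for T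
      by (simp add: algebra_simps)
    then show ?thesis .
  qed
  finally show ?case using size by (simp add: k_def Suc_diff_Suc numeral_2_eq_2)
qed auto

text \<open>The products contribute the one rounding by which the number of nonzero coefficients exceeds the number
  of additions. If all coefficients vanish, no operation is performed and the result is exact.\<close>

lemma fl_scalar_prod_error:
  assumes eps: "0 \<le> \<epsilon>" and "fl_scalar_prod \<epsilon> a x y"
  shows "\<bar>y - (\<Sum>j<dim_vec a. a $ j * x $ j)\<bar>
    \<le> ((1 + \<epsilon>) ^ nnz a - 1) * (\<Sum>j<dim_vec a. \<bar>a $ j\<bar> * \<bar>x $ j\<bar>)"
proof -
  define J where "J = {j. j < dim_vec a \<and> a $ j \<noteq> 0}"
  have fin: "finite J" unfolding J_def by simp
  obtain c where c: "\<And>j. j \<in> J \<Longrightarrow> fl_round \<epsilon> (a $ j * x $ j) (c j)"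
    and y: "fl_sum \<epsilon> (image_mset c (mset_set J)) y"
    using assms(2) unfolding fl_scalar_prod_def J_def by auto
  let ?S = "\<Sum>j\<in>J. a $ j * x $ j" and ?T = "\<Sum>j\<in>J. \<bar>a $ j\<bar> * \<bar>x $ j\<bar>"
  have sums: "(\<Sum>j<dim_vec a. a $ j * x $ j) = ?S" "(\<Sum>j<dim_vec a. \<bar>a $ j\<bar> * \<bar>x $ j\<bar>) = ?T"
    by (rule sum.mono_neutral_right; auto simp: J_def)+
  have c1: "\<bar>c j - a $ j * x $ j\<bar> \<le> \<epsilon> * (\<bar>a $ j\<bar> * \<bar>x $ j\<bar>)" if j: "j \<in> J" for j
  proof -
    obtain \<delta> where "\<bar>\<delta>\<bar> \<le> \<epsilon>" "c j = a $ j * x $ j * (1 + \<delta>)"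
      using c[OF j] by (auto simp: fl_round_def)
    moreover from this have "c j - a $ j * x $ j = \<delta> * (a $ j * x $ j)"
      by (simp add: algebra_simps)
    ultimately show ?thesis by (simp add: abs_mult mult_right_mono)
  qed
  have c2: "\<bar>c j\<bar> \<le> (1 + \<epsilon>) * (\<bar>a $ j\<bar> * \<bar>x $ j\<bar>)" if "j \<in> J" for j
    using c1[OF that] abs_mult[of "a $ j" "x $ j"] unfolding distrib_right by linarith
  have C1: "\<bar>(\<Sum>j\<in>J. c j) - ?S\<bar> \<le> \<epsilon> * ?T"
    unfolding sum_subtractf[symmetric] sum_distrib_left
    by (rule order_trans[OF sum_abs]) (intro sum_mono c1)
  have C2: "(\<Sum>j\<in>J. \<bar>c j\<bar>) \<le> (1 + \<epsilon>) * ?T"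
    unfolding sum_distrib_left by (intro sum_mono c2)
  have sz: "size (image_mset c (mset_set J)) = nnz a"
    by (simp add: nnz_def J_def)
  have F: "\<bar>y - (\<Sum>j\<in>J. c j)\<bar> \<le> ((1 + \<epsilon>) ^ (nnz a - 1) - 1) * (\<Sum>j\<in>J. \<bar>c j\<bar>)"
    using fl_sum_error[OF eps y] unfolding sz
    by (simp add: sum_unfold_sum_mset image_mset.compositionality comp_def)
  show ?thesis
  proof (cases "nnz a")
    case 0
    then have "J = {}" using fin by (simp add: nnz_def J_def)
    with F show ?thesis unfolding sums by simp
  next
    case (Suc k)
    have "\<bar>y - ?S\<bar> \<le> ((1 + \<epsilon>) ^ k - 1) * (\<Sum>j\<in>J. \<bar>c j\<bar>) + \<epsilon> * ?T"
      using F C1 Suc by simp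
    also have "\<dots> \<le> ((1 + \<epsilon>) ^ k - 1) * ((1 + \<epsilon>) * ?T) + \<epsilon> * ?T"
      using C2 eps by (intro add_mono mult_left_mono) auto
    also have "\<dots> = ((1 + \<epsilon>) ^ nnz a - 1) * ?T"
      by (simp add: Suc algebra_simps)
    finally show ?thesis unfolding sums .
  qed
qed

lemma fl_lincomb_carrier: "fl_lincomb \<epsilon> s a xs y \<Longrightarrow> y \<in> carrier_vec s"
  by (simp add: fl_lincomb_def)

text \<open>The entrywise error bounds are themselves the entries of a linear combination, that of the vectors
  \<open>\<bar>xs j\<bar>\<close> with coefficients \<open>\<bar>a\<^sub>j\<bar>\<close>; monotonicity and Minkowski's inequality turn them into norms.\<close>

lemma fl_lincomb_error:
  assumes p: "1 \<le> p" and eps: "0 \<le> \<epsilon>" and fl: "fl_lincomb \<epsilon> s a xs y"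
    and xs: "\<And>j. j < dim_vec a \<Longrightarrow> xs j \<in> carrier_vec s"
  shows "lp_norm p (y - lincomb s a xs)
    \<le> ((1 + \<epsilon>) ^ nnz a - 1) * (\<Sum>j<dim_vec a. \<bar>a $ j\<bar> * lp_norm p (xs j))"
proof -
  let ?c = "(1 + \<epsilon>) ^ nnz a - 1"
  let ?a = "vec (dim_vec a) (\<lambda>j. \<bar>a $ j\<bar>)" and ?xs = "\<lambda>j. vec s (\<lambda>t. \<bar>xs j $ t\<bar>)"
  have c: "0 \<le> ?c" using eps by simp
  have "\<bar>(y - lincomb s a xs) $ t\<bar> \<le> ?c * lincomb s ?a ?xs $ t" if "t < s" for t
  proof -
    have "fl_scalar_prod \<epsilon> a (vec (dim_vec a) (\<lambda>j. xs j $ t)) (y $ t)"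
      using fl that by (simp add: fl_lincomb_def)
    from fl_scalar_prod_error[OF eps this] show ?thesis
      using that by (simp add: lincomb_def)
  qed
  then have "lp_norm p (y - lincomb s a xs) \<le> lp_norm p (vec s (\<lambda>t. ?c * lincomb s ?a ?xs $ t))"
    by (intro lp_norm_mono p) (auto simp: lincomb_def intro: order_trans[OF _ abs_ge_self])
  also have "\<dots> = ?c * lp_norm p (vec s (\<lambda>t. lincomb s ?a ?xs $ t))"
    using c by (simp add: lp_norm_smult[OF p])
  also have "vec s (\<lambda>t. lincomb s ?a ?xs $ t) = lincomb s ?a ?xs"
    by (auto simp: lincomb_def intro!: eq_vecI)
  also have "lp_norm p (lincomb s ?a ?xs) \<le> (\<Sum>j<dim_vec a. \<bar>a $ j\<bar> * lp_norm p (?xs j))"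
    using lp_norm_lincomb_le[OF p, of ?a ?xs s] by simp
  also have "\<dots> \<le> (\<Sum>j<dim_vec a. \<bar>a $ j\<bar> * lp_norm p (xs j))"
    using carrier_vecD[OF xs] by (intro sum_mono mult_left_mono lp_norm_mono p) auto
  finally show ?thesis using c by (simp add: mult_left_mono)
qed

text \<open>The amplification principle for linear combinations: exact terms of norm at most \<open>M j\<close>, known up to
  \<open>H j - M j\<close>, give a result known up to the same expression with each \<open>H j\<close> multiplied by \<open>(1 + \<epsilon>)\<^sup>k\<close>. The
  rounding errors are proportional to the computed terms, whose norms are at most \<open>H j\<close>.\<close>

lemma fl_lincomb_propagation:
  assumes p: "1 \<le> p" and eps: "0 \<le> \<epsilon>" and fl: "fl_lincomb \<epsilon> s a xs' y"
    and xs: "\<And>j. j < dim_vec a \<Longrightarrow> xs j \<in> carrier_vec s"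
    and xs': "\<And>j. j < dim_vec a \<Longrightarrow> xs' j \<in> carrier_vec s"
    and M: "\<And>j. j < dim_vec a \<Longrightarrow> lp_norm p (xs j) \<le> M j"
    and H: "\<And>j. j < dim_vec a \<Longrightarrow> lp_norm p (xs' j - xs j) \<le> H j - M j"
  shows "lp_norm p (y - lincomb s a xs)
    \<le> (\<Sum>j<dim_vec a. \<bar>a $ j\<bar> * ((1 + \<epsilon>) ^ nnz a * H j - M j))"
proof -
  let ?c = "(1 + \<epsilon>) ^ nnz a"
  have H': "lp_norm p (xs' j) \<le> H j" if "j < dim_vec a" for j
    using lp_norm_via_diff[OF p xs'[OF that] xs[OF that]] M[OF that] H[OF that] by linarith
  have "lp_norm p (y - lincomb s a xs)
      \<le> lp_norm p (y - lincomb s a xs') + lp_norm p (lincomb s a xs' - lincomb s a xs)"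
    using fl_lincomb_carrier[OF fl] by (intro lp_norm_diff_triangle[OF p, of _ s]) auto
  also have "lp_norm p (y - lincomb s a xs') \<le> (?c - 1) * (\<Sum>j<dim_vec a. \<bar>a $ j\<bar> * H j)"
    using H' eps
    by (intro order_trans[OF fl_lincomb_error[OF p eps fl xs']] mult_left_mono sum_mono) auto
  also have "lp_norm p (lincomb s a xs' - lincomb s a xs) \<le> (\<Sum>j<dim_vec a. \<bar>a $ j\<bar> * (H j - M j))"
  proof -
    have "lincomb s a xs' - lincomb s a xs = lincomb s a (\<lambda>j. xs' j - xs j)"
      using xs' xs by (rule lincomb_diff)
    moreover have "lp_norm p (lincomb s a (\<lambda>j. xs' j - xs j))
        \<le> (\<Sum>j<dim_vec a. \<bar>a $ j\<bar> * lp_norm p (xs' j - xs j))"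
      using xs xs' by (intro lp_norm_lincomb_le p minus_carrier_vec)
    moreover have "\<dots> \<le> (\<Sum>j<dim_vec a. \<bar>a $ j\<bar> * (H j - M j))"
      using H by (intro sum_mono mult_left_mono) auto
    ultimately show ?thesis by simp
  qed
  also have "(?c - 1) * (\<Sum>j<dim_vec a. \<bar>a $ j\<bar> * H j) + (\<Sum>j<dim_vec a. \<bar>a $ j\<bar> * (H j - M j))
      = (\<Sum>j<dim_vec a. \<bar>a $ j\<bar> * (?c * H j - M j))"
    unfolding sum_distrib_left sum.distrib[symmetric]
    by (intro sum.cong refl) (simp add: algebra_simps)
  finally show ?thesis by simp
qed

text \<open>The case of exactly known blocks, which occurs at the inputs of every recursion step.\<close>

lemma fl_lincomb_blocks_error:
  assumes p: "1 \<le> p" and eps: "0 \<le> \<epsilon>" and fl: "fl_lincomb \<epsilon> s a (block s u) y"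
    and u: "u \<in> carrier_vec (dim_vec a * s)"
  shows "lp_norm p (lincomb s a (block s u)) \<le> lp_dual_norm p a * lp_norm p u"
    and "lp_norm p (y - lincomb s a (block s u))
      \<le> ((1 + \<epsilon>) ^ nnz a - 1) * (lp_dual_norm p a * lp_norm p u)"
proof -
  show "lp_norm p (lincomb s a (block s u)) \<le> lp_dual_norm p a * lp_norm p u"
    by (rule order_trans[OF lp_norm_lincomb_le[OF p] weighted_block_norms_le[OF p u]]) simp
  have "0 \<le> (1 + \<epsilon>) ^ nnz a - 1" using eps by simp
  then show "lp_norm p (y - lincomb s a (block s u))
      \<le> ((1 + \<epsilon>) ^ nnz a - 1) * (lp_dual_norm p a * lp_norm p u)"
    using weighted_block_norms_le[OF p u]
    by (intro order_trans[OF fl_lincomb_error[OF p eps fl]] mult_left_mono) auto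
qed


section \<open>Tensor powers\<close>

lemma kronecker_carrier:
  "A \<in> carrier_mat a b \<Longrightarrow> C \<in> carrier_mat c d \<Longrightarrow> kronecker A C \<in> carrier_mat (a * c) (b * d)"
  by (auto simp: kronecker_def)

lemma kronecker_power_carrier:
  "kronecker_power A l \<in> carrier_mat (dim_row A ^ l) (dim_col A ^ l)"
  by (induction l) (auto simp: intro!: kronecker_carrier)

lemma tensor_power_carrier:
  "tensor_power s A l \<in> carrier_mat (dim_row A ^ l * s) (dim_col A ^ l * s)"
  unfolding tensor_power_def by (intro kronecker_carrier kronecker_power_carrier) simp

lemma kronecker_assoc: "kronecker (kronecker A B) C = kronecker A (kronecker B C)"
proof (rule eq_matI)
  fix i j
  assume "i < dim_row (kronecker A (kronecker B C))" "j < dim_col (kronecker A (kronecker B C))"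
  then have i: "i < dim_row A * (dim_row B * dim_row C)" and j: "j < dim_col A * (dim_col B * dim_col C)"
    by (simp_all add: kronecker_def)
  have split: "t div c < a * b" "t div c div b = t div (b * c)" "t div c mod b = t mod (b * c) div c"
    "t mod c = t mod (b * c) mod c" "t div (b * c) < a" "t mod (b * c) < b * c"
    if t: "t < a * (b * c)" for t a b c :: nat
  proof -
    have "0 < c" "0 < b" using t by (auto intro!: gr0I)
    then show "t div c < a * b" "t div c div b = t div (b * c)" "t div c mod b = t mod (b * c) div c"
        "t mod c = t mod (b * c) mod c" "t div (b * c) < a" "t mod (b * c) < b * c"
      using t index_div_mod[of t a "b * c"] index_div_mod[of t "a * b" c]
      by (simp_all add: mult.assoc mult.commute[of b c] div_mult2_eq mod_mult2_eq)
  qed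
  have "kronecker (kronecker A B) C $$ (i, j)
      = A $$ (i div dim_row C div dim_row B, j div dim_col C div dim_col B)
        * B $$ (i div dim_row C mod dim_row B, j div dim_col C mod dim_col B)
        * C $$ (i mod dim_row C, j mod dim_col C)"
    using i j split(1)[OF i] split(1)[OF j] by (simp add: kronecker_def mult.assoc)
  also have "\<dots> = kronecker A (kronecker B C) $$ (i, j)"
    using i j split(2-)[OF i] split(2-)[OF j] by (simp add: kronecker_def mult.assoc)
  finally show "kronecker (kronecker A B) C $$ (i, j) = kronecker A (kronecker B C) $$ (i, j)" .
qed (simp_all add: kronecker_def mult.assoc)

lemma tensor_power_0: "tensor_power s A 0 = 1\<^sub>m s"
  by (rule eq_matI) (auto simp: tensor_power_def kronecker_def)

lemma tensor_power_Suc: "tensor_power s A (Suc l) = kronecker A (tensor_power s A l)"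
  by (simp add: tensor_power_def kronecker_assoc)

lemma transpose_kronecker:
  "transpose_mat (kronecker A B) = kronecker (transpose_mat A) (transpose_mat B)"
proof (rule eq_matI)
  fix i j
  assume "i < dim_row (kronecker (transpose_mat A) (transpose_mat B))"
    and "j < dim_col (kronecker (transpose_mat A) (transpose_mat B))"
  then have ij: "i < dim_col A * dim_col B" "j < dim_row A * dim_row B"
    by (simp_all add: kronecker_def)
  show "transpose_mat (kronecker A B) $$ (i, j) = kronecker (transpose_mat A) (transpose_mat B) $$ (i, j)"
    using ij index_div_mod[OF ij(1)] index_div_mod[OF ij(2)] by (simp add: kronecker_def)
qed (simp_all add: kronecker_def)

lemma transpose_tensor_power:
  "transpose_mat (tensor_power s A l) = tensor_power s (transpose_mat A) l"
  by (induction l) (simp_all add: tensor_power_0 tensor_power_Suc transpose_kronecker)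

text \<open>A Kronecker product acts on the vector of blocks by its left factor, with the right factor acting inside the
  blocks. By linearity, either factor may be applied first, which gives the two recursions below; they are the
  exact counterparts of the two orders of floating point execution.\<close>

lemma kronecker_mult_vec:
  assumes u: "u \<in> carrier_vec (dim_col A * dim_col M)"
  shows "kronecker A M *\<^sub>v u =
    glue (dim_row M) (dim_row A) (\<lambda>i. lincomb (dim_row M) (row A i) (\<lambda>j. M *\<^sub>v block (dim_col M) u j))"
proof (rule eq_vecI)
  let ?r = "dim_row M" and ?c = "dim_col M"
  let ?G = "glue ?r (dim_row A) (\<lambda>i. lincomb ?r (row A i) (\<lambda>j. M *\<^sub>v block ?c u j))"
  fix t assume "t < dim_vec ?G"
  then have t: "t < dim_row A * ?r" by (simp add: glue_def)
  note td = index_div_mod[OF t]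
  have "(kronecker A M *\<^sub>v u) $ t
      = (\<Sum>x<dim_col A * ?c. A $$ (t div ?r, x div ?c) * M $$ (t mod ?r, x mod ?c) * u $ x)"
    using t u by (auto simp: kronecker_def scalar_prod_def atLeast0LessThan carrier_vecD intro!: sum.cong)
  also have "\<dots> = (\<Sum>j<dim_col A. \<Sum>k<?c. A $$ (t div ?r, j) * (M $$ (t mod ?r, k) * u $ (j * ?c + k)))"
    unfolding sum_blocks by (intro sum.cong refl) (simp add: mult.assoc)
  also have "\<dots> = ?G $ t"
    using t td by (simp add: glue_def lincomb_def block_def scalar_prod_def atLeast0LessThan sum_distrib_left)
  finally show "(kronecker A M *\<^sub>v u) $ t = ?G $ t" .
qed (simp add: kronecker_def glue_def)

lemma lincomb_mult_mat_vec:
  assumes M: "M \<in> carrier_mat r c" and xs: "\<And>j. j < dim_vec a \<Longrightarrow> xs j \<in> carrier_vec c"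
  shows "lincomb r a (\<lambda>j. M *\<^sub>v xs j) = M *\<^sub>v lincomb c a xs"
proof (rule eq_vecI)
  fix t assume "t < dim_vec (M *\<^sub>v lincomb c a xs)"
  then have t: "t < r" using M by simp
  have "lincomb r a (\<lambda>j. M *\<^sub>v xs j) $ t
      = (\<Sum>j<dim_vec a. \<Sum>k<c. a $ j * (M $$ (t, k) * xs j $ k))"
    using t M carrier_vecD[OF xs]
    by (auto simp: lincomb_def scalar_prod_def atLeast0LessThan sum_distrib_left intro!: sum.cong)
  also have "\<dots> = (\<Sum>k<c. \<Sum>j<dim_vec a. a $ j * (M $$ (t, k) * xs j $ k))"
    by (rule sum.swap)
  also have "\<dots> = (M *\<^sub>v lincomb c a xs) $ t"
    using t M
    by (auto simp: lincomb_def scalar_prod_def atLeast0LessThan sum_distrib_left mult_ac intro!: sum.cong)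
  finally show "lincomb r a (\<lambda>j. M *\<^sub>v xs j) $ t = (M *\<^sub>v lincomb c a xs) $ t" .
qed (use M in \<open>simp add: lincomb_def\<close>)

lemma tensor_power_outer_last:
  assumes "u \<in> carrier_vec (s * dim_col A ^ Suc l)"
  shows "tensor_power s A (Suc l) *\<^sub>v u =
    glue (s * dim_row A ^ l) (dim_row A) (\<lambda>i. lincomb (s * dim_row A ^ l) (row A i)
      (\<lambda>j. tensor_power s A l *\<^sub>v block (s * dim_col A ^ l) u j))"
  using kronecker_mult_vec[of u A "tensor_power s A l"] tensor_power_carrier[of s A l] assms
  by (simp add: tensor_power_Suc carrier_matD[OF tensor_power_carrier] mult_ac)

lemma tensor_power_outer_first:
  assumes "u \<in> carrier_vec (s * dim_col A ^ Suc l)"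
  shows "tensor_power s A (Suc l) *\<^sub>v u =
    glue (s * dim_row A ^ l) (dim_row A) (\<lambda>i. tensor_power s A l *\<^sub>v
      lincomb (s * dim_col A ^ l) (row A i) (block (s * dim_col A ^ l) u))"
proof -
  have "tensor_power s A l \<in> carrier_mat (s * dim_row A ^ l) (s * dim_col A ^ l)"
    using tensor_power_carrier[of s A l] by (simp add: mult.commute)
  from lincomb_mult_mat_vec[OF this] show ?thesis
    unfolding tensor_power_outer_last[OF assms] by simp
qed

lemma mat_norm_nonneg: "0 \<le> mat_norm p A"
  by (simp add: mat_norm_def)

lemma tensor_power_mult_carrier:
  "tensor_power s A l *\<^sub>v u \<in> carrier_vec (s * dim_row A ^ l)"
  by (rule carrier_vecI) (simp add: carrier_matD[OF tensor_power_carrier] mult.commute)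

lemma lp_norm_tensor_power_le:
  assumes p: "1 \<le> p" and "u \<in> carrier_vec (s * dim_col A ^ l)"
  shows "lp_norm p (tensor_power s A l *\<^sub>v u) \<le> mat_norm p A ^ l * lp_norm p u"
  using assms(2)
proof (induction l arbitrary: u)
  case 0
  then show ?case by (simp add: tensor_power_0)
next
  case (Suc l)
  let ?c = "s * dim_col A ^ l" and ?r = "s * dim_row A ^ l" and ?N = "mat_norm p A ^ l * lp_norm p u"
  have N: "0 \<le> ?N" by (simp add: mat_norm_nonneg)
  have u: "u \<in> carrier_vec (dim_col A * ?c)" using Suc.prems by (simp add: mult_ac)
  have "lp_norm p (tensor_power s A (Suc l) *\<^sub>v u)
      \<le> lp_norm p (vec (dim_row A) (\<lambda>i. ?N * lp_dual_norm p (row A i)))"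
    unfolding tensor_power_outer_first[OF Suc.prems]
  proof (rule lp_norm_glue_le[OF p])
    fix i assume i: "i < dim_row A"
    let ?x = "lincomb ?c (row A i) (block ?c u)"
    show "tensor_power s A l *\<^sub>v ?x \<in> carrier_vec ?r"
      by (rule tensor_power_mult_carrier)
    have "lp_norm p (tensor_power s A l *\<^sub>v ?x) \<le> mat_norm p A ^ l * lp_norm p ?x"
      by (rule Suc.IH) simp
    also have "lp_norm p ?x \<le> lp_dual_norm p (row A i) * lp_norm p u"
      using u by (intro order_trans[OF lp_norm_lincomb_le[OF p] weighted_block_norms_le[OF p]]) auto
    finally have "lp_norm p (tensor_power s A l *\<^sub>v ?x)
        \<le> mat_norm p A ^ l * (lp_dual_norm p (row A i) * lp_norm p u)"
      by (simp add: mult_left_mono mat_norm_nonneg)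
    then show "lp_norm p (tensor_power s A l *\<^sub>v ?x) \<le> ?N * lp_dual_norm p (row A i)"
      by (simp add: mult_ac)
  qed
  also have "\<dots> = mat_norm p A ^ Suc l * lp_norm p u"
    unfolding lp_norm_smult[OF p] abs_of_nonneg[OF N] by (simp add: mat_norm_def)
  finally show ?case .
qed

lemma nnz_row_le_max_row_nnz: "i < dim_row A \<Longrightarrow> nnz (row A i) \<le> max_row_nnz A"
  unfolding max_row_nnz_def by (intro Max_ge) auto

lemma lp_norm_glue_rows_le:
  assumes p: "1 \<le> p" and c: "0 \<le> c" and xs: "\<And>i. i < dim_row A \<Longrightarrow> xs i \<in> carrier_vec s"
    and le: "\<And>i. i < dim_row A \<Longrightarrow> lp_norm p (xs i) \<le> c * lp_dual_norm p (row A i)"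
  shows "lp_norm p (glue s (dim_row A) xs) \<le> c * mat_norm p A"
proof -
  have "lp_norm p (glue s (dim_row A) xs) \<le> lp_norm p (vec (dim_row A) (\<lambda>i. c * lp_dual_norm p (row A i)))"
    using xs le by (rule lp_norm_glue_le[OF p])
  also have "\<dots> = c * mat_norm p A"
    unfolding lp_norm_smult[OF p] abs_of_nonneg[OF c] by (simp add: mat_norm_def)
  finally show ?thesis .
qed

text \<open>The amplification principle for a computed tensor power with relative error \<open>\<kappa> - 1\<close>.\<close>

lemma tensor_power_propagation:
  assumes p: "1 \<le> p" and \<kappa>: "1 \<le> \<kappa>"
    and y: "y \<in> carrier_vec (s * dim_row A ^ l)"
    and x': "x' \<in> carrier_vec (s * dim_col A ^ l)" and x: "x \<in> carrier_vec (s * dim_col A ^ l)"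
    and err: "lp_norm p (y - tensor_power s A l *\<^sub>v x') \<le> (\<kappa> - 1) * (mat_norm p A ^ l * lp_norm p x')"
    and M: "lp_norm p x \<le> M" and H: "lp_norm p (x' - x) \<le> H - M"
  shows "lp_norm p (y - tensor_power s A l *\<^sub>v x) \<le> mat_norm p A ^ l * (\<kappa> * H - M)"
proof -
  let ?T = "tensor_power s A l" and ?N = "mat_norm p A ^ l"
  have N: "0 \<le> ?N" by (simp add: mat_norm_nonneg)
  have T: "?T \<in> carrier_mat (s * dim_row A ^ l) (s * dim_col A ^ l)"
    using tensor_power_carrier[of s A l] by (simp add: mult.commute)
  have x'_le: "lp_norm p x' \<le> H"
    using lp_norm_via_diff[OF p x' x] M H by linarith
  have "(\<kappa> - 1) * (?N * lp_norm p x') \<le> (\<kappa> - 1) * (?N * H)"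
    using x'_le N \<kappa> by (intro mult_left_mono) auto
  with err have 1: "lp_norm p (y - ?T *\<^sub>v x') \<le> (\<kappa> - 1) * (?N * H)" by linarith
  have "?T *\<^sub>v x' - ?T *\<^sub>v x = ?T *\<^sub>v (x' - x)"
    using T x x' by (simp add: mult_minus_distrib_mat_vec)
  moreover have "lp_norm p (?T *\<^sub>v (x' - x)) \<le> ?N * lp_norm p (x' - x)"
    using x x' by (intro lp_norm_tensor_power_le p minus_carrier_vec)
  moreover have "\<dots> \<le> ?N * (H - M)" using H N by (rule mult_left_mono)
  ultimately have 2: "lp_norm p (?T *\<^sub>v x' - ?T *\<^sub>v x) \<le> ?N * (H - M)" by simp
  have "lp_norm p (y - ?T *\<^sub>v x) \<le> (\<kappa> - 1) * (?N * H) + ?N * (H - M)"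
    using lp_norm_diff_triangle[OF p y tensor_power_mult_carrier[of s A l x'] tensor_power_mult_carrier[of s A l x]] 1 2
    by linarith
  then show ?thesis by (simp add: algebra_simps)
qed

text \<open>Each of the \<open>l\<close> factors costs the amplification \<open>(1 + \<epsilon>)\<^sup>Q\<close> and the norm \<open>\<parallel>A\<parallel>\<close>, in whichever order the
  levels are processed: if the outermost factor comes first, the error of the combined blocks passes through
  the remaining levels; if it comes last, the error of the remaining levels passes through the combination.\<close>

lemma fl_tensor_power_error:
  assumes p: "1 \<le> p" and eps: "0 \<le> \<epsilon>"
    and "fl_tensor_power \<epsilon> s A l u w" and "u \<in> carrier_vec (s * dim_col A ^ l)"
  shows "w \<in> carrier_vec (s * dim_row A ^ l) \<and>
    lp_norm p (w - tensor_power s A l *\<^sub>v u)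
      \<le> ((1 + \<epsilon>) ^ (l * max_row_nnz A) - 1) * (mat_norm p A ^ l * lp_norm p u)"
  using assms(3,4)
proof induction
  case (fl_tensor_power_0 u)
  moreover from this have "tensor_power s A 0 *\<^sub>v u = u"
    by (simp add: tensor_power_0)
  moreover from fl_tensor_power_0 have "u - u = vec s (\<lambda>_. 0)"
    by (auto intro!: eq_vecI)
  ultimately show ?case by (simp add: lp_norm_zero_fun[OF p])
next
  case (fl_tensor_power_outer_first l u xs ys)
  let ?c = "s * dim_col A ^ l" and ?r = "s * dim_row A ^ l" and ?Q = "max_row_nnz A"
  let ?N = "mat_norm p A ^ l" and ?T = "tensor_power s A l"
  define \<rho> where "\<rho> = (1 + \<epsilon>) ^ ?Q"
  have \<rho>: "1 \<le> \<rho>" using eps by (simp add: \<rho>_def)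
  have \<rho>': "0 \<le> \<rho> ^ Suc l - 1" using one_le_power[OF \<rho>, of "Suc l"] by simp
  have \<rho>l: "(1 + \<epsilon>) ^ (l * ?Q) = \<rho> ^ l" for l
    by (simp add: \<rho>_def power_mult[symmetric] mult.commute)
  have N: "0 \<le> ?N" by (simp add: mat_norm_nonneg)
  have T: "?T \<in> carrier_mat ?r ?c"
    using tensor_power_carrier[of s A l] by (simp add: mult.commute)
  let ?x = "\<lambda>i. lincomb ?c (row A i) (block ?c u)"
  have u: "u \<in> carrier_vec (dim_col A * ?c)" using fl_tensor_power_outer_first.prems by (simp add: mult_ac)
  have ys: "ys i \<in> carrier_vec ?r"
    and le: "lp_norm p (ys i - ?T *\<^sub>v ?x i)
      \<le> (\<rho> ^ Suc l - 1) * (?N * lp_norm p u) * lp_dual_norm p (row A i)"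
    if i: "i < dim_row A" for i
  proof -
    note fl = fl_tensor_power_outer_first.hyps(1)[OF i]
    have x: "xs i \<in> carrier_vec ?c" by (rule fl_lincomb_carrier[OF fl])
    let ?D = "lp_dual_norm p (row A i) * lp_norm p u"
    have D: "0 \<le> ?D" by (simp add: lp_dual_norm_nonneg[OF p])
    note IH = fl_tensor_power_outer_first.IH[OF i x]
    show ysi: "ys i \<in> carrier_vec ?r" using IH by simp
    have D1: "lp_norm p (?x i) \<le> ?D" 
      using fl_lincomb_blocks_error(1)[OF p eps fl] u by simp
    have "lp_norm p (xs i - ?x i) \<le> ((1 + \<epsilon>) ^ nnz (row A i) - 1) * ?D"
      using fl_lincomb_blocks_error(2)[OF p eps fl] u by simp
    also have "\<dots> \<le> (\<rho> - 1) * ?D"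
      unfolding \<rho>_def using eps nnz_row_le_max_row_nnz[OF i] D
      by (intro mult_right_mono diff_right_mono power_increasing) auto
    finally have D2: "lp_norm p (xs i - ?x i) \<le> (\<rho> - 1) * ?D" .
    have "lp_norm p (ys i - ?T *\<^sub>v ?x i) \<le> ?N * (\<rho> ^ l * (\<rho> * ?D) - ?D)"
      using IH \<rho> D1 D2 ysi x unfolding \<rho>l
      by (intro tensor_power_propagation[OF p, where x' = "xs i"]) (auto simp: left_diff_distrib)
    then show "lp_norm p (ys i - ?T *\<^sub>v ?x i)
        \<le> (\<rho> ^ Suc l - 1) * (?N * lp_norm p u) * lp_dual_norm p (row A i)"
      by (simp add: algebra_simps)
  qed
  have "lp_norm p (glue ?r (dim_row A) (\<lambda>i. ys i - ?T *\<^sub>v ?x i))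
      \<le> (\<rho> ^ Suc l - 1) * (?N * lp_norm p u) * mat_norm p A"
    using le ys \<rho>' N tensor_power_mult_carrier
    by (intro lp_norm_glue_rows_le[OF p] minus_carrier_vec mult_nonneg_nonneg) auto
  then show ?case
    using glue_diff[of "dim_row A" ys ?r "\<lambda>i. ?T *\<^sub>v ?x i"] ys tensor_power_mult_carrier
      glue_carrier[of ?r "dim_row A" ys]
    unfolding tensor_power_outer_first[OF fl_tensor_power_outer_first.prems] \<rho>l
    by (auto simp: mult_ac)
next
  case (fl_tensor_power_outer_last l u xs ys)
  let ?c = "s * dim_col A ^ l" and ?r = "s * dim_row A ^ l" and ?Q = "max_row_nnz A"
  let ?N = "mat_norm p A ^ l" and ?T = "tensor_power s A l"
  define \<rho> where "\<rho> = (1 + \<epsilon>) ^ ?Q"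
  have \<rho>: "1 \<le> \<rho>" using eps by (simp add: \<rho>_def)
  have \<rho>': "0 \<le> \<rho> ^ Suc l - 1" using one_le_power[OF \<rho>, of "Suc l"] by simp
  have \<rho>l: "(1 + \<epsilon>) ^ (l * ?Q) = \<rho> ^ l" for l
    by (simp add: \<rho>_def power_mult[symmetric] mult.commute)
  have N: "0 \<le> ?N" by (simp add: mat_norm_nonneg)
  let ?x = "\<lambda>j. ?T *\<^sub>v block ?c u j"
  have u: "u \<in> carrier_vec (dim_col A * ?c)" using fl_tensor_power_outer_last.prems by (simp add: mult_ac)
  have T: "?x j \<in> carrier_vec ?r" for j by (rule tensor_power_mult_carrier)
  note IH = fl_tensor_power_outer_last.IH[OF _ block_carrier, unfolded \<rho>l]
  have ys: "ys i \<in> carrier_vec ?r"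
    and le: "lp_norm p (ys i - lincomb ?r (row A i) ?x)
      \<le> (\<rho> ^ Suc l - 1) * (?N * lp_norm p u) * lp_dual_norm p (row A i)"
    if i: "i < dim_row A" for i
  proof -
    note fl = fl_tensor_power_outer_last.hyps(2)[OF i]
    show "ys i \<in> carrier_vec ?r" by (rule fl_lincomb_carrier[OF fl])
    have "lp_norm p (ys i - lincomb ?r (row A i) ?x)
        \<le> (\<Sum>j<dim_vec (row A i). \<bar>row A i $ j\<bar> * ((1 + \<epsilon>) ^ nnz (row A i)
            * (\<rho> ^ l * (?N * lp_norm p (block ?c u j))) - ?N * lp_norm p (block ?c u j)))"
      using IH T lp_norm_tensor_power_le[OF p block_carrier]
      by (intro fl_lincomb_propagation[OF p eps fl]) (auto simp: algebra_simps)
    also have "\<dots> \<le> (\<Sum>j<dim_vec (row A i). \<bar>row A i $ j\<bar> * (\<rho>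
            * (\<rho> ^ l * (?N * lp_norm p (block ?c u j))) - ?N * lp_norm p (block ?c u j)))"
      unfolding \<rho>_def using eps nnz_row_le_max_row_nnz[OF i] N
      by (intro sum_mono mult_left_mono diff_right_mono mult_right_mono power_increasing) auto
    also have "\<dots> = (\<rho> ^ Suc l - 1) * ?N * (\<Sum>j<dim_vec (row A i). \<bar>row A i $ j\<bar> * lp_norm p (block ?c u j))"
      by (simp add: sum_distrib_left algebra_simps)
    also have "\<dots> \<le> (\<rho> ^ Suc l - 1) * ?N * (lp_dual_norm p (row A i) * lp_norm p u)"
      using weighted_block_norms_le[OF p, of u "row A i" ?c] u N \<rho>'
      by (intro mult_left_mono mult_nonneg_nonneg) auto
    finally show "lp_norm p (ys i - lincomb ?r (row A i) ?x)
      \<le> (\<rho> ^ Suc l - 1) * (?N * lp_norm p u) * lp_dual_norm p (row A i)"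
      by (simp add: mult_ac)
  qed
  have "lp_norm p (glue ?r (dim_row A) (\<lambda>i. ys i - lincomb ?r (row A i) ?x))
      \<le> (\<rho> ^ Suc l - 1) * (?N * lp_norm p u) * mat_norm p A"
    using le ys \<rho>' N by (intro lp_norm_glue_rows_le[OF p] minus_carrier_vec mult_nonneg_nonneg) auto
  then show ?case
    using glue_diff[of "dim_row A" ys ?r "\<lambda>i. lincomb ?r (row A i) ?x"] ys
      glue_carrier[of ?r "dim_row A" ys]
    unfolding tensor_power_outer_last[OF fl_tensor_power_outer_last.prems] \<rho>l
    by (auto simp: mult_ac)
qed


section \<open>Bilinear maps under perturbation\<close>

lemma bilinear_map_carrier:
  "bilinear_map e f g \<beta> \<Longrightarrow> u \<in> carrier_vec e \<Longrightarrow> v \<in> carrier_vec f \<Longrightarrow> \<beta> u v \<in> carrier_vec g"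
  by (simp add: bilinear_map_def)

lemma bilinear_map_diff_left:
  assumes b: "bilinear_map e f g \<beta>"
    and u: "u \<in> carrier_vec e" "u' \<in> carrier_vec e" and v: "v \<in> carrier_vec f"
  shows "\<beta> (u' - u) v = \<beta> u' v - \<beta> u v"
proof -
  have "u' = (u' - u) + u" using u by (auto intro!: eq_vecI)
  moreover have "u' - u \<in> carrier_vec e" using u by (rule minus_carrier_vec[rotated])
  ultimately have "\<beta> u' v = \<beta> (u' - u) v + \<beta> u v"
    using b u v unfolding bilinear_map_def by metis
  moreover have "\<beta> (u' - u) v \<in> carrier_vec g" "\<beta> u v \<in> carrier_vec g"
    using u v by (auto intro!: bilinear_map_carrier[OF b])
  ultimately show ?thesis by (auto intro!: eq_vecI)
qed

lemma bilinear_map_diff_right: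
  assumes b: "bilinear_map e f g \<beta>"
    and u: "u \<in> carrier_vec e" and v: "v \<in> carrier_vec f" "v' \<in> carrier_vec f"
  shows "\<beta> u (v' - v) = \<beta> u v' - \<beta> u v"
proof -
  have "v' = (v' - v) + v" using v by (auto intro!: eq_vecI)
  moreover have "v' - v \<in> carrier_vec f" using v by (rule minus_carrier_vec[rotated])
  ultimately have "\<beta> u v' = \<beta> u (v' - v) + \<beta> u v"
    using b u v unfolding bilinear_map_def by metis
  moreover have "\<beta> u (v' - v) \<in> carrier_vec g" "\<beta> u v \<in> carrier_vec g"
    using u v by (auto intro!: bilinear_map_carrier[OF b])
  ultimately show ?thesis by (auto intro!: eq_vecI)
qed

text \<open>The amplification principle for bilinear maps: perturbing the arguments one at a time costs
  \<open>G (\<sigma> - 1) \<tau> + G (\<tau> - 1) = G (\<sigma> \<tau> - 1)\<close>, and the error \<open>H - G\<close> of the map itself is measured at the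
  perturbed arguments, hence enters as \<open>(H - G) \<sigma> \<tau>\<close>. These add up to \<open>\<sigma> \<tau> H - G\<close>.\<close>

lemma bilinear_propagation:
  assumes p: "1 \<le> p" and q: "1 \<le> q" and b: "bilinear_map e f g \<beta>"
    and bound: "\<And>u v. u \<in> carrier_vec e \<Longrightarrow> v \<in> carrier_vec f \<Longrightarrow>
      lp_norm p (\<beta> u v) \<le> G * (lp_norm q u * lp_norm q v)"
    and G: "0 \<le> G" "G \<le> H"
    and u: "u \<in> carrier_vec e" "u' \<in> carrier_vec e" and v: "v \<in> carrier_vec f" "v' \<in> carrier_vec f"
    and w: "w \<in> carrier_vec g"
    and nu: "lp_norm q u \<le> a" "lp_norm q (u' - u) \<le> (\<sigma> - 1) * a"
    and nv: "lp_norm q v \<le> c" "lp_norm q (v' - v) \<le> (\<tau> - 1) * c"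
    and err: "lp_norm p (w - \<beta> u' v') \<le> (H - G) * (lp_norm q u' * lp_norm q v') + \<eta>"
  shows "lp_norm p (w - \<beta> u v) \<le> (\<sigma> * \<tau> * H - G) * (a * c) + \<eta>"
proof -
  have u': "lp_norm q u' \<le> \<sigma> * a"
    using lp_norm_via_diff[OF q u(2,1)] nu by (simp add: algebra_simps)
  have v': "lp_norm q v' \<le> \<tau> * c"
    using lp_norm_via_diff[OF q v(2,1)] nv by (simp add: algebra_simps)
  have nonneg: "0 \<le> a" "0 \<le> \<sigma> * a" "0 \<le> (\<sigma> - 1) * a"
    using order_trans[OF lp_norm_nonneg nu(1)] order_trans[OF lp_norm_nonneg u']
      order_trans[OF lp_norm_nonneg nu(2)] by auto
  have du: "u' - u \<in> carrier_vec e" and dv: "v' - v \<in> carrier_vec f"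
    using u v by (auto intro: minus_carrier_vec)
  have "(H - G) * (lp_norm q u' * lp_norm q v') \<le> (H - G) * (\<sigma> * a * (\<tau> * c))"
    using u' v' nonneg G by (intro mult_left_mono mult_mono) auto
  with err have 1: "lp_norm p (w - \<beta> u' v') \<le> (H - G) * (\<sigma> * a * (\<tau> * c)) + \<eta>" by linarith
  have "lp_norm p (\<beta> u' v' - \<beta> u v') \<le> G * (lp_norm q (u' - u) * lp_norm q v')"
    using bound[OF du v(2)] bilinear_map_diff_left[OF b u v(2)] by simp
  also have "\<dots> \<le> G * ((\<sigma> - 1) * a * (\<tau> * c))"
    using v' nu nonneg G by (intro mult_left_mono mult_mono) auto
  finally have 2: "lp_norm p (\<beta> u' v' - \<beta> u v') \<le> G * ((\<sigma> - 1) * a * (\<tau> * c))" .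
  have "lp_norm p (\<beta> u v' - \<beta> u v) \<le> G * (lp_norm q u * lp_norm q (v' - v))"
    using bound[OF u(1) dv] bilinear_map_diff_right[OF b u(1) v] by simp
  also have "\<dots> \<le> G * (a * ((\<tau> - 1) * c))"
    using nu nv nonneg G by (intro mult_left_mono mult_mono) auto
  finally have 3: "lp_norm p (\<beta> u v' - \<beta> u v) \<le> G * (a * ((\<tau> - 1) * c))" .
  note carrier = bilinear_map_carrier[OF b]
  have "lp_norm p (w - \<beta> u v)
      \<le> lp_norm p (w - \<beta> u' v') + (lp_norm p (\<beta> u' v' - \<beta> u v') + lp_norm p (\<beta> u v' - \<beta> u v))"
    using lp_norm_diff_triangle[OF p w carrier[OF u(2) v(2)] carrier[OF u(1) v(1)]]
      lp_norm_diff_triangle[OF p carrier[OF u(2) v(2)] carrier[OF u(1) v(2)] carrier[OF u(1) v(1)]]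
    by linarith
  also have "\<dots> \<le> (H - G) * (\<sigma> * a * (\<tau> * c)) + \<eta>
      + (G * ((\<sigma> - 1) * a * (\<tau> * c)) + G * (a * ((\<tau> - 1) * c)))"
    using 1 2 3 by linarith
  finally show ?thesis by (simp add: algebra_simps)
qed

lemma lincomb_block_add:
  assumes "u \<in> carrier_vec (dim_vec a * s)" "u' \<in> carrier_vec (dim_vec a * s)"
  shows "lincomb s a (block s (u + u')) = lincomb s a (block s u) + lincomb s a (block s u')"
  using assms block_index_less
  by (auto simp: lincomb_def block_def distrib_left simp flip: sum.distrib intro!: eq_vecI sum.cong)

lemma lincomb_block_smult:
  assumes "u \<in> carrier_vec (dim_vec a * s)"
  shows "lincomb s a (block s (c \<cdot>\<^sub>v u)) = c \<cdot>\<^sub>v lincomb s a (block s u)"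
  using assms block_index_less
  by (auto simp: lincomb_def block_def sum_distrib_left intro!: eq_vecI sum.cong)

lemma glue_lincomb_add:
  assumes "\<And>j i. j < n \<Longrightarrow> i < dim_vec (a j) \<Longrightarrow> xs i = ys i + zs i"
    and "\<And>j i. j < n \<Longrightarrow> i < dim_vec (a j) \<Longrightarrow> zs i \<in> carrier_vec s"
  shows "glue s n (\<lambda>j. lincomb s (a j) xs)
    = glue s n (\<lambda>j. lincomb s (a j) ys) + glue s n (\<lambda>j. lincomb s (a j) zs)"
proof (rule eq_vecI)
  fix t assume "t < dim_vec (glue s n (\<lambda>j. lincomb s (a j) ys) + glue s n (\<lambda>j. lincomb s (a j) zs))"
  then have t: "t < n * s" by (simp add: glue_def)
  note td = index_div_mod[OF t]
  show "glue s n (\<lambda>j. lincomb s (a j) xs) $ t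
    = (glue s n (\<lambda>j. lincomb s (a j) ys) + glue s n (\<lambda>j. lincomb s (a j) zs)) $ t"
    using t td assms(1)[OF td(1)] carrier_vecD[OF assms(2)[OF td(1)]]
    by (auto simp: glue_def lincomb_def distrib_left simp flip: sum.distrib intro!: sum.cong)
qed (simp add: glue_def)

lemma glue_lincomb_smult:
  assumes "\<And>j i. j < n \<Longrightarrow> i < dim_vec (a j) \<Longrightarrow> xs i = c \<cdot>\<^sub>v ys i"
    and "\<And>j i. j < n \<Longrightarrow> i < dim_vec (a j) \<Longrightarrow> ys i \<in> carrier_vec s"
  shows "glue s n (\<lambda>j. lincomb s (a j) xs) = c \<cdot>\<^sub>v glue s n (\<lambda>j. lincomb s (a j) ys)"
proof (rule eq_vecI)
  fix t assume "t < dim_vec (c \<cdot>\<^sub>v glue s n (\<lambda>j. lincomb s (a j) ys))"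
  then have t: "t < n * s" by (simp add: glue_def)
  note td = index_div_mod[OF t]
  show "glue s n (\<lambda>j. lincomb s (a j) xs) $ t = (c \<cdot>\<^sub>v glue s n (\<lambda>j. lincomb s (a j) ys)) $ t"
    using t td assms(1)[OF td(1)] carrier_vecD[OF assms(2)[OF td(1)]]
    by (auto simp: glue_def lincomb_def sum_distrib_left intro!: sum.cong)
qed (simp add: glue_def)

text \<open>Bilinearity of the exact recursive map is what allows the errors of its inputs to be separated from the
  errors of its evaluation.\<close>

lemma bilinear_map_beta_ab:
  assumes b: "bilinear_map e0 f0 g0 \<beta>0"
    and L: "L \<in> carrier_mat r e'" and R: "R \<in> carrier_mat r f'" and P: "P \<in> carrier_mat g' r"
  shows "bilinear_map (e0 * e' ^ l) (f0 * f' ^ l) (g0 * g' ^ l) (beta_ab \<beta>0 e0 f0 g0 L R P l)"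
proof (induction l)
  case 0
  have "beta_ab \<beta>0 e0 f0 g0 L R P 0 = \<beta>0" by (intro ext) simp
  with b show ?case by simp
next
  case (Suc l)
  let ?se = "e0 * e' ^ l" and ?sf = "f0 * f' ^ l" and ?sg = "g0 * g' ^ l"
  let ?\<beta> = "beta_ab \<beta>0 e0 f0 g0 L R P l"
  let ?x = "\<lambda>u i. lincomb ?se (row L i) (block ?se u)" and ?y = "\<lambda>v i. lincomb ?sf (row R i) (block ?sf v)"
  let ?G = "\<lambda>ws. glue ?sg g' (\<lambda>j. lincomb ?sg (row P j) ws)"
  have rec: "beta_ab \<beta>0 e0 f0 g0 L R P (Suc l) u v = ?G (\<lambda>i. ?\<beta> (?x u i) (?y v i))" for u v
    using L R P by (simp add: Let_def)
  have dims: "e0 * e' ^ Suc l = e' * ?se" "f0 * f' ^ Suc l = f' * ?sf" "g0 * g' ^ Suc l = g' * ?sg"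
    by simp_all
  have rows: "dim_vec (row L i) = e'" "dim_vec (row R i) = f'" "dim_vec (row P j) = r" for i j
    using L R P by auto
  have cx: "?x u i \<in> carrier_vec ?se" and cy: "?y v i \<in> carrier_vec ?sf" for u v i by simp_all
  note B = Suc.IH[unfolded bilinear_map_def]
  have cw: "?\<beta> (?x u i) (?y v i) \<in> carrier_vec ?sg" for u v i
    using B cx cy by blast
  show ?case
    unfolding bilinear_map_def dims rec
  proof (intro conjI ballI allI)
    fix u u' v v' :: "real vec" and c :: real
    assume u: "u \<in> carrier_vec (e' * ?se)" and v: "v \<in> carrier_vec (f' * ?sf)"
    show "?G (\<lambda>i. ?\<beta> (?x u i) (?y v i)) \<in> carrier_vec (g' * ?sg)" by simp
    have "?x (c \<cdot>\<^sub>v u) i = c \<cdot>\<^sub>v ?x u i" "?y (c \<cdot>\<^sub>v v) i = c \<cdot>\<^sub>v ?y v i" for i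
      using u v L R by (auto intro!: lincomb_block_smult simp: rows)
    then show "?G (\<lambda>i. ?\<beta> (?x (c \<cdot>\<^sub>v u) i) (?y v i)) = c \<cdot>\<^sub>v ?G (\<lambda>i. ?\<beta> (?x u i) (?y v i))"
      and "?G (\<lambda>i. ?\<beta> (?x u i) (?y (c \<cdot>\<^sub>v v) i)) = c \<cdot>\<^sub>v ?G (\<lambda>i. ?\<beta> (?x u i) (?y v i))"
      using B cx cy cw by (auto intro!: glue_lincomb_smult)
    {
      assume u': "u' \<in> carrier_vec (e' * ?se)"
      have "?x (u + u') i = ?x u i + ?x u' i" for i
        using u u' L by (intro lincomb_block_add) (simp_all add: rows)
      then show "?G (\<lambda>i. ?\<beta> (?x (u + u') i) (?y v i))
          = ?G (\<lambda>i. ?\<beta> (?x u i) (?y v i)) + ?G (\<lambda>i. ?\<beta> (?x u' i) (?y v i))"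
        using B cx cy cw by (intro glue_lincomb_add) auto
    }
    {
      assume v': "v' \<in> carrier_vec (f' * ?sf)"
      have "?y (v + v') i = ?y v i + ?y v' i" for i
        using v v' R by (intro lincomb_block_add) (simp_all add: rows)
      then show "?G (\<lambda>i. ?\<beta> (?x u i) (?y (v + v') i))
          = ?G (\<lambda>i. ?\<beta> (?x u i) (?y v i)) + ?G (\<lambda>i. ?\<beta> (?x u i) (?y v' i))"
        using B cx cy cw by (intro glue_lincomb_add) auto
    }
  qed
qed


section \<open>The sparsified recursion\<close>

lemma gamma_ab_nonneg: "0 \<le> gamma_ab p q L R P"
  by (simp add: gamma_ab_def)

text \<open>\<open>Q\<^sub>0\<close> counts the roundings along every path that is actually used: from the inputs through the \<open>i\<close>-th
  product to the \<open>j\<close>-th output block, for \<open>P\<^sub>j\<^sub>i \<noteq> 0\<close>.\<close>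

lemma nnz_le_Q_ab:
  assumes j: "j < dim_row P"
  shows "nnz (row P j) \<le> Q_ab L R P"
    and "i < dim_col P \<Longrightarrow> P $$ (j, i) \<noteq> 0 \<Longrightarrow>
      nnz (row P j) + (nnz (row L i) + nnz (row R i)) \<le> Q_ab L R P"
proof -
  let ?m = "\<lambda>j. MAX i\<in>{..<dim_col P}. (nnz (row L i) + nnz (row R i)) * of_bool (P $$ (j, i) \<noteq> 0)"
  have le: "nnz (row P j) + ?m j \<le> Q_ab L R P"
    unfolding Q_ab_def using j by (intro Max_ge) auto
  then show "nnz (row P j) \<le> Q_ab L R P" by linarith
  assume i: "i < dim_col P" and nz: "P $$ (j, i) \<noteq> 0"
  have "(nnz (row L i) + nnz (row R i)) * of_bool (P $$ (j, i) \<noteq> 0) \<le> ?m j"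
    using i by (intro Max_ge) auto
  with le nz show "nnz (row P j) + (nnz (row L i) + nnz (row R i)) \<le> Q_ab L R P" by simp
qed

locale recursive_bilinear =
  fixes p q :: ereal
    and \<beta>0 :: "real vec \<Rightarrow> real vec \<Rightarrow> real vec"
    and e0 f0 g0 e' f' g' r :: nat
    and L R P :: "real mat"
    and \<gamma>0 :: real
  assumes p: "1 \<le> p" and q: "1 \<le> q"
    and L: "L \<in> carrier_mat r e'" and R: "R \<in> carrier_mat r f'" and P: "P \<in> carrier_mat g' r"
    and bilinear: "bilinear_map e0 f0 g0 \<beta>0"
    and base_norm: "\<And>u v. u \<in> carrier_vec e0 \<Longrightarrow> v \<in> carrier_vec f0 \<Longrightarrow>
      lp_norm p (\<beta>0 u v) \<le> \<gamma>0 * lp_norm q u * lp_norm q v"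
    and \<gamma>0: "0 \<le> \<gamma>0"
begin

abbreviation "\<beta> \<equiv> beta_ab \<beta>0 e0 f0 g0 L R P"
abbreviation "\<gamma> \<equiv> gamma_ab p q L R P"

definition row_weight :: "nat \<Rightarrow> real" where
  "row_weight j = (\<Sum>i<r. \<bar>P $$ (j, i)\<bar> * (lp_dual_norm q (row L i) * lp_dual_norm q (row R i)))"

lemma lp_norm_row_weight: "lp_norm p (vec g' row_weight) = \<gamma>"
  using P unfolding gamma_ab_def row_weight_def by (simp add: mult_ac)

lemma dim_rows: "dim_vec (row L i) = e'" "dim_vec (row R i) = f'" "dim_vec (row P j) = r"
  using L R P by auto

lemma beta_carrier:
  "u \<in> carrier_vec (e0 * e' ^ l) \<Longrightarrow> v \<in> carrier_vec (f0 * f' ^ l) \<Longrightarrow> \<beta> l u v \<in> carrier_vec (g0 * g' ^ l)"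
  by (rule bilinear_map_carrier[OF bilinear_map_beta_ab[OF bilinear L R P]])

lemma beta_Suc:
  "\<beta> (Suc l) u v = glue (g0 * g' ^ l) g' (\<lambda>j. lincomb (g0 * g' ^ l) (row P j) (\<lambda>i.
     \<beta> l (lincomb (e0 * e' ^ l) (row L i) (block (e0 * e' ^ l) u))
       (lincomb (f0 * f' ^ l) (row R i) (block (f0 * f' ^ l) v))))"
  using L R P by (simp add: Let_def)

lemma beta_norm_le:
  assumes "u \<in> carrier_vec (e0 * e' ^ l)" and "v \<in> carrier_vec (f0 * f' ^ l)"
  shows "lp_norm p (\<beta> l u v) \<le> \<gamma> ^ l * \<gamma>0 * (lp_norm q u * lp_norm q v)"
  using assms
proof (induction l arbitrary: u v)
  case 0
  then show ?case using base_norm[of u v] by (simp add: mult_ac)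
next
  case (Suc l)
  let ?se = "e0 * e' ^ l" and ?sf = "f0 * f' ^ l" and ?sg = "g0 * g' ^ l"
  define G where "G = \<gamma> ^ l * \<gamma>0"
  let ?N = "G * (lp_norm q u * lp_norm q v)"
  let ?x = "\<lambda>i. lincomb ?se (row L i) (block ?se u)" and ?y = "\<lambda>i. lincomb ?sf (row R i) (block ?sf v)"
  have G: "0 \<le> G" using \<gamma>0 by (simp add: G_def gamma_ab_nonneg)
  then have N: "0 \<le> ?N" by simp
  have u: "u \<in> carrier_vec (dim_vec (row L i) * ?se)" and v: "v \<in> carrier_vec (dim_vec (row R i) * ?sf)" for i
    using Suc.prems unfolding dim_rows by (simp_all add: mult_ac)
  have x: "lp_norm q (?x i) \<le> lp_dual_norm q (row L i) * lp_norm q u"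
    and y: "lp_norm q (?y i) \<le> lp_dual_norm q (row R i) * lp_norm q v" for i
    by (rule order_trans[OF lp_norm_lincomb_le[OF q block_carrier] weighted_block_norms_le[OF q u]],
        rule order_trans[OF lp_norm_lincomb_le[OF q block_carrier] weighted_block_norms_le[OF q v]])
  have z: "lp_norm p (\<beta> l (?x i) (?y i)) \<le> ?N * (lp_dual_norm q (row L i) * lp_dual_norm q (row R i))" for i
  proof -
    have "lp_norm p (\<beta> l (?x i) (?y i)) \<le> G * (lp_norm q (?x i) * lp_norm q (?y i))"
      unfolding G_def by (intro Suc.IH) simp_all
    also have "\<dots> \<le> G * (lp_dual_norm q (row L i) * lp_norm q u * (lp_dual_norm q (row R i) * lp_norm q v))"
      using x y G lp_dual_norm_nonneg[OF q] by (intro mult_left_mono mult_mono) auto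
    finally show ?thesis by (simp add: mult_ac)
  qed
  have "lp_norm p (\<beta> (Suc l) u v) \<le> lp_norm p (vec g' (\<lambda>j. ?N * row_weight j))"
    unfolding beta_Suc
  proof (rule lp_norm_glue_le[OF p])
    fix j assume j: "j < g'"
    have "lp_norm p (lincomb ?sg (row P j) (\<lambda>i. \<beta> l (?x i) (?y i)))
        \<le> (\<Sum>i<r. \<bar>row P j $ i\<bar> * lp_norm p (\<beta> l (?x i) (?y i)))"
      unfolding dim_rows(3)[of j, symmetric] by (intro lp_norm_lincomb_le[OF p] beta_carrier) simp_all
    also have "\<dots> \<le> (\<Sum>i<r. \<bar>row P j $ i\<bar> * (?N * (lp_dual_norm q (row L i) * lp_dual_norm q (row R i))))"
      using z by (intro sum_mono mult_left_mono) auto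
    also have "\<dots> = ?N * row_weight j"
      unfolding row_weight_def sum_distrib_left using j P by (intro sum.cong) (auto simp: mult_ac)
    finally show "lp_norm p (lincomb ?sg (row P j) (\<lambda>i. \<beta> l (?x i) (?y i))) \<le> ?N * row_weight j" .
  qed simp
  also have "\<dots> = \<gamma> ^ Suc l * \<gamma>0 * (lp_norm q u * lp_norm q v)"
    unfolding lp_norm_smult[OF p] lp_norm_row_weight abs_of_nonneg[OF N] by (simp add: G_def mult_ac)
  finally show ?case .
qed

text \<open>One level of recursion multiplies an additive error of the recursive calls by at most this factor. Such an error
  does not scale with the inputs: it only passes through the combinations given by \<open>P\<close>, whence the row sums of
  \<open>\<bar>P\<bar>\<close>.\<close>

definition slack_factor :: "real \<Rightarrow> real" where
  "slack_factor \<epsilon> = (1 + \<epsilon>) ^ Q_ab L R P * lp_norm p (vec g' (\<lambda>j. \<Sum>i<r. \<bar>P $$ (j, i)\<bar>))"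

text \<open>Here \<open>c\<close> stands for \<open>c\<^sub>0 \<epsilon>\<close>. The error of the base case is only known on a bounded set of inputs; \<open>X\<close>
  bounds the growth of the computed inputs per level, so that all leaves of the recursion are
  reached with inputs in that set.\<close>

lemma fl_beta_ab_error:
  fixes B :: fl_map
  assumes eps: "0 \<le> \<epsilon>" and c: "0 \<le> c" and \<eta>: "0 \<le> \<eta>"
    and base: "\<And>u v w. u \<in> carrier_vec e0 \<Longrightarrow> v \<in> carrier_vec f0 \<Longrightarrow>
      lp_norm q u \<le> K \<Longrightarrow> lp_norm q v \<le> K \<Longrightarrow> B \<epsilon> u v w \<Longrightarrow>
      w \<in> carrier_vec g0 \<and> lp_norm p (w - \<beta>0 u v) \<le> c * (lp_norm q u * lp_norm q v) + \<eta>"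
    and XL: "\<And>i. i < r \<Longrightarrow> (1 + \<epsilon>) ^ nnz (row L i) * lp_dual_norm q (row L i) \<le> X"
    and XR: "\<And>i. i < r \<Longrightarrow> (1 + \<epsilon>) ^ nnz (row R i) * lp_dual_norm q (row R i) \<le> X"
    and X: "0 \<le> X"
    and u: "u \<in> carrier_vec (e0 * e' ^ l)" and v: "v \<in> carrier_vec (f0 * f' ^ l)"
    and uK: "X ^ l * lp_norm q u \<le> K" and vK: "X ^ l * lp_norm q v \<le> K"
    and fl: "fl_beta_ab B e0 f0 g0 L R P l \<epsilon> u v w"
  shows "w \<in> carrier_vec (g0 * g' ^ l) \<and> lp_norm p (w - \<beta> l u v)
    \<le> (\<gamma> ^ l * ((1 + \<epsilon>) ^ (l * Q_ab L R P) * (\<gamma>0 + c)) - \<gamma> ^ l * \<gamma>0) * (lp_norm q u * lp_norm q v)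
      + slack_factor \<epsilon> ^ l * \<eta>"
  using u v uK vK fl
proof (induction l arbitrary: u v w)
  case 0
  then show ?case using base[of u v w] by simp
next
  case (Suc l)
  let ?se = "e0 * e' ^ l" and ?sf = "f0 * f' ^ l" and ?sg = "g0 * g' ^ l"
  let ?x = "\<lambda>i. lincomb ?se (row L i) (block ?se u)" and ?y = "\<lambda>i. lincomb ?sf (row R i) (block ?sf v)"
  let ?z = "\<lambda>i. \<beta> l (?x i) (?y i)"
  define G where "G = \<gamma> ^ l * \<gamma>0"
  define H where "H = \<gamma> ^ l * ((1 + \<epsilon>) ^ (l * Q_ab L R P) * (\<gamma>0 + c))"
  define \<rho> where "\<rho> = (1 + \<epsilon>) ^ Q_ab L R P"
  define \<theta> where "\<theta> = slack_factor \<epsilon> ^ l * \<eta>"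
  define U where "U = lp_norm q u * lp_norm q v"
  define D where "D = (\<lambda>i. lp_dual_norm q (row L i) * lp_dual_norm q (row R i))"
  define \<sigma> where "\<sigma> = (\<lambda>i. (1 + \<epsilon>) ^ nnz (row L i))"
  define \<tau> where "\<tau> = (\<lambda>i. (1 + \<epsilon>) ^ nnz (row R i))"
  have G: "0 \<le> G" using \<gamma>0 by (simp add: G_def gamma_ab_nonneg)
  have GH: "G \<le> H"
  proof -
    have "1 * \<gamma>0 \<le> (1 + \<epsilon>) ^ (l * Q_ab L R P) * (\<gamma>0 + c)"
      using eps c \<gamma>0 by (intro mult_mono) auto
    then show ?thesis unfolding G_def H_def by (simp add: gamma_ab_nonneg mult_left_mono)
  qed
  have \<beta>_le: "lp_norm p (\<beta> l u v) \<le> G * (lp_norm q u * lp_norm q v)"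
    if "u \<in> carrier_vec ?se" "v \<in> carrier_vec ?sf" for u v
    unfolding G_def using that by (rule beta_norm_le)
  have cx: "?x i \<in> carrier_vec ?se" and cy: "?y i \<in> carrier_vec ?sf" for i by simp_all
  have H: "0 \<le> H" using G GH by linarith
  have \<rho>: "1 \<le> \<rho>" using eps by (simp add: \<rho>_def)
  have slack: "0 \<le> slack_factor \<epsilon>" using eps by (simp add: slack_factor_def)
  then have \<theta>: "0 \<le> \<theta>" using \<eta> by (simp add: \<theta>_def)
  have U: "0 \<le> U" by (simp add: U_def)
  have D: "0 \<le> D i" for i by (simp add: D_def lp_dual_norm_nonneg[OF q])
  have u: "u \<in> carrier_vec (dim_vec (row L i) * ?se)" and v: "v \<in> carrier_vec (dim_vec (row R i) * ?sf)" for i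
    using Suc.prems unfolding dim_rows by (simp_all add: mult_ac)
  obtain us vs ws ys where
    us: "\<And>i. i < r \<Longrightarrow> fl_lincomb \<epsilon> ?se (row L i) (block ?se u) (us i)" and
    vs: "\<And>i. i < r \<Longrightarrow> fl_lincomb \<epsilon> ?sf (row R i) (block ?sf v) (vs i)" and
    ws: "\<And>i. i < r \<Longrightarrow> fl_beta_ab B e0 f0 g0 L R P l \<epsilon> (us i) (vs i) (ws i)" and
    ys: "\<And>j. j < g' \<Longrightarrow> fl_lincomb \<epsilon> ?sg (row P j) ws (ys j)" and
    w: "w = glue ?sg g' ys"
  proof -
    have "\<exists>us vs ws ys. (\<forall>i<r. fl_lincomb \<epsilon> ?se (row L i) (block ?se u) (us i) \<and>
        fl_lincomb \<epsilon> ?sf (row R i) (block ?sf v) (vs i) \<and> fl_beta_ab B e0 f0 g0 L R P l \<epsilon> (us i) (vs i) (ws i)) \<and>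
      (\<forall>j<g'. fl_lincomb \<epsilon> ?sg (row P j) ws (ys j)) \<and> w = glue ?sg g' ys"
      using Suc.prems(5) L R P by (simp add: Let_def)
    with that show thesis by blast
  qed
  have z_norm: "lp_norm p (?z i) \<le> G * (D i * U)" and ws_carrier: "i < r \<Longrightarrow> ws i \<in> carrier_vec ?sg"
    and ws_err: "i < r \<Longrightarrow> lp_norm p (ws i - ?z i) \<le> (\<sigma> i * \<tau> i * H - G) * (D i * U) + \<theta>" for i
  proof -
    let ?a = "lp_dual_norm q (row L i) * lp_norm q u" and ?b = "lp_dual_norm q (row R i) * lp_norm q v"
    have ab: "?a * ?b = D i * U" by (simp add: D_def U_def mult_ac)
    have a0: "0 \<le> ?a" by (simp add: lp_dual_norm_nonneg[OF q])
    have x: "lp_norm q (?x i) \<le> ?a"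
      by (rule order_trans[OF lp_norm_lincomb_le[OF q block_carrier] weighted_block_norms_le[OF q u]])
    have y: "lp_norm q (?y i) \<le> ?b"
      by (rule order_trans[OF lp_norm_lincomb_le[OF q block_carrier] weighted_block_norms_le[OF q v]])
    have "lp_norm p (?z i) \<le> G * (lp_norm q (?x i) * lp_norm q (?y i))"
      unfolding G_def by (intro beta_norm_le) simp_all
    also have "\<dots> \<le> G * (?a * ?b)"
      using x y a0 G by (intro mult_left_mono mult_mono) auto
    finally show "lp_norm p (?z i) \<le> G * (D i * U)" unfolding ab .
    assume i: "i < r"
    have cu: "us i \<in> carrier_vec ?se" by (rule fl_lincomb_carrier[OF us[OF i]])
    have cv: "vs i \<in> carrier_vec ?sf" by (rule fl_lincomb_carrier[OF vs[OF i]])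
    have dx: "lp_norm q (us i - ?x i) \<le> (\<sigma> i - 1) * ?a"
      unfolding \<sigma>_def by (rule fl_lincomb_blocks_error(2)[OF q eps us[OF i] u])
    have dy: "lp_norm q (vs i - ?y i) \<le> (\<tau> i - 1) * ?b"
      unfolding \<tau>_def by (rule fl_lincomb_blocks_error(2)[OF q eps vs[OF i] v])
    have "lp_norm q (us i) \<le> \<sigma> i * ?a"
      using lp_norm_via_diff[OF q cu, of "?x i"] x dx by (simp add: algebra_simps)
    also have "\<dots> \<le> X * lp_norm q u"
      using mult_right_mono[OF XL[OF i], of "lp_norm q u"] by (simp add: \<sigma>_def mult.assoc)
    finally have "X ^ l * lp_norm q (us i) \<le> X ^ l * (X * lp_norm q u)"
      using X by (intro mult_left_mono) auto
    with Suc.prems(3) have uK: "X ^ l * lp_norm q (us i) \<le> K" by (simp add: mult_ac)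
    have "lp_norm q (vs i) \<le> \<tau> i * ?b"
      using lp_norm_via_diff[OF q cv, of "?y i"] y dy by (simp add: algebra_simps)
    also have "\<dots> \<le> X * lp_norm q v"
      using mult_right_mono[OF XR[OF i], of "lp_norm q v"] by (simp add: \<tau>_def mult.assoc)
    finally have "X ^ l * lp_norm q (vs i) \<le> X ^ l * (X * lp_norm q v)"
      using X by (intro mult_left_mono) auto
    with Suc.prems(4) have vK: "X ^ l * lp_norm q (vs i) \<le> K" by (simp add: mult_ac)
    note IH = Suc.IH[OF cu cv uK vK ws[OF i], folded G_def H_def \<theta>_def]
    show "ws i \<in> carrier_vec ?sg" using IH by simp
    have "lp_norm p (ws i - ?z i) \<le> (\<sigma> i * \<tau> i * H - G) * (?a * ?b) + \<theta>"
      by (rule bilinear_propagation[OF p q bilinear_map_beta_ab[OF bilinear L R P]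
            \<beta>_le G GH cx cu cy cv
            conjunct1[OF IH] x dx y dy conjunct2[OF IH]])
    then show "lp_norm p (ws i - ?z i) \<le> (\<sigma> i * \<tau> i * H - G) * (D i * U) + \<theta>" unfolding ab .
  qed
  have z_carrier: "?z i \<in> carrier_vec ?sg" for i by (rule beta_carrier) simp_all
  let ?s = "\<lambda>j. \<Sum>i<r. \<bar>P $$ (j, i)\<bar>"
  have row: "lp_norm p (ys j - lincomb ?sg (row P j) ?z) \<le> (\<rho> * H - G) * U * row_weight j + \<rho> * \<theta> * ?s j"
    if j: "j < g'" for j
  proof -
    let ?d = "(1 + \<epsilon>) ^ nnz (row P j)"
    have Pj: "row P j $ i = P $$ (j, i)" if "i < r" for i using P j that by simp
    have jP: "j < dim_row P" using P j by simp
    have "lp_norm p (ys j - lincomb ?sg (row P j) ?z)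
        \<le> (\<Sum>i<r. \<bar>row P j $ i\<bar> * (?d * (\<sigma> i * \<tau> i * H * (D i * U) + \<theta>) - G * (D i * U)))"
      unfolding dim_rows(3)[of j, symmetric]
    proof (rule fl_lincomb_propagation[OF p eps ys[OF j]])
      fix i assume "i < dim_vec (row P j)"
      then have i: "i < r" using P by simp
      show "lp_norm p (ws i - ?z i) \<le> \<sigma> i * \<tau> i * H * (D i * U) + \<theta> - G * (D i * U)"
        using ws_err[OF i] by (simp add: left_diff_distrib)
    qed (use P in \<open>simp_all add: ws_carrier z_carrier z_norm\<close>)
    also have "\<dots> \<le> (\<Sum>i<r. \<bar>P $$ (j, i)\<bar> * ((\<rho> * H - G) * (D i * U) + \<rho> * \<theta>))"
    proof (rule sum_mono)
      fix i assume "i \<in> {..<r}"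
      then have i: "i < r" by simp
      show "\<bar>row P j $ i\<bar> * (?d * (\<sigma> i * \<tau> i * H * (D i * U) + \<theta>) - G * (D i * U))
          \<le> \<bar>P $$ (j, i)\<bar> * ((\<rho> * H - G) * (D i * U) + \<rho> * \<theta>)"
      proof (cases "P $$ (j, i) = 0")
        case False
        \<comment> \<open>the roundings on the path through the \<open>i\<close>-th product; zero entries of \<open>P\<close> contribute no path\<close>
        have "?d * \<sigma> i * \<tau> i = (1 + \<epsilon>) ^ (nnz (row P j) + (nnz (row L i) + nnz (row R i)))"
          by (simp add: \<sigma>_def \<tau>_def power_add)
        also have "\<dots> \<le> \<rho>"
          unfolding \<rho>_def using nnz_le_Q_ab(2)[OF jP _ False] i P eps by (intro power_increasing) auto
        finally have "?d * \<sigma> i * \<tau> i * (H * (D i * U)) \<le> \<rho> * (H * (D i * U))"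
          using H D U by (intro mult_right_mono) auto
        moreover have "?d \<le> \<rho>"
          unfolding \<rho>_def using nnz_le_Q_ab(1)[OF jP] eps by (intro power_increasing) auto
        then have "?d * \<theta> \<le> \<rho> * \<theta>" using \<theta> by (rule mult_right_mono)
        ultimately have "?d * (\<sigma> i * \<tau> i * H * (D i * U) + \<theta>) - G * (D i * U)
            \<le> (\<rho> * H - G) * (D i * U) + \<rho> * \<theta>"
          by (simp add: algebra_simps)
        then show ?thesis unfolding Pj[OF i] by (rule mult_left_mono) simp
      qed (simp add: Pj[OF i])
    qed
    also have "\<dots> = (\<rho> * H - G) * U * row_weight j + \<rho> * \<theta> * ?s j"
      unfolding row_weight_def D_def sum_distrib_left sum.distrib[symmetric]
      by (intro sum.cong refl) (simp add: algebra_simps)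
    finally show ?thesis .
  qed
  have HG: "0 \<le> \<rho> * H - G"
    using mult_right_mono[OF \<rho> H] GH by simp
  have ys_carrier: "j < g' \<Longrightarrow> ys j \<in> carrier_vec ?sg" for j by (rule fl_lincomb_carrier[OF ys])
  have "w - \<beta> (Suc l) u v = glue ?sg g' (\<lambda>j. ys j - lincomb ?sg (row P j) ?z)"
    unfolding w beta_Suc by (rule glue_diff[OF ys_carrier]) simp_all
  then have "lp_norm p (w - \<beta> (Suc l) u v)
      \<le> lp_norm p (vec g' (\<lambda>j. (\<rho> * H - G) * U * row_weight j + \<rho> * \<theta> * ?s j))"
    using lp_norm_glue_le[OF p _ row, of g' "\<lambda>j. j"] ys_carrier
    by (simp add: lp_norm_glue_le[OF p _ row] minus_carrier_vec)
  also have "\<dots> \<le> (\<rho> * H - G) * U * \<gamma> + \<rho> * \<theta> * lp_norm p (vec g' ?s)"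
    using lp_norm_triangle[OF p, of g' "\<lambda>j. (\<rho> * H - G) * U * row_weight j" "\<lambda>j. \<rho> * \<theta> * ?s j"]
      HG U \<rho> \<theta> unfolding lp_norm_smult[OF p] lp_norm_row_weight by simp
  also have "\<rho> * \<theta> * lp_norm p (vec g' ?s) = slack_factor \<epsilon> ^ Suc l * \<eta>"
    by (simp add: \<theta>_def slack_factor_def \<rho>_def)
  also have "(\<rho> * H - G) * U * \<gamma> = (\<gamma> ^ Suc l * ((1 + \<epsilon>) ^ (Suc l * Q_ab L R P) * (\<gamma>0 + c)) - \<gamma> ^ Suc l * \<gamma>0) * U"
    by (simp add: G_def H_def \<rho>_def power_add algebra_simps)
  finally show ?case
    using w glue_carrier[of ?sg g' ys] by (simp add: U_def mult_ac)
qed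

end


section \<open>The alternative basis algorithm\<close>

context recursive_bilinear
begin

text \<open>The three stages are composed by \<open>bilinear_propagation\<close>, for the inputs transformed by \<open>\<phi>\<close> and \<open>\<psi>\<close>, and
  \<open>tensor_power_propagation\<close>, for the transformation of the output by \<open>\<nu>\<^sup>T\<close>.\<close>

lemma fl_beta_mmab_error:
  fixes B :: fl_map and \<phi> \<psi> \<nu> :: "real mat"
  assumes \<phi>: "\<phi> \<in> carrier_mat e' e" and \<psi>: "\<psi> \<in> carrier_mat f' f" and \<nu>: "\<nu> \<in> carrier_mat g' g"
    and eps: "0 \<le> \<epsilon>" and c: "0 \<le> c" and \<eta>: "0 \<le> \<eta>"
    and base: "\<And>u v w. u \<in> carrier_vec e0 \<Longrightarrow> v \<in> carrier_vec f0 \<Longrightarrow>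
      lp_norm q u \<le> K \<Longrightarrow> lp_norm q v \<le> K \<Longrightarrow> B \<epsilon> u v w \<Longrightarrow>
      w \<in> carrier_vec g0 \<and> lp_norm p (w - \<beta>0 u v) \<le> c * (lp_norm q u * lp_norm q v) + \<eta>"
    and XL: "\<And>i. i < r \<Longrightarrow> (1 + \<epsilon>) ^ nnz (row L i) * lp_dual_norm q (row L i) \<le> X"
    and XR: "\<And>i. i < r \<Longrightarrow> (1 + \<epsilon>) ^ nnz (row R i) * lp_dual_norm q (row R i) \<le> X"
    and X: "0 \<le> X"
    and u: "u \<in> carrier_vec (e0 * e ^ l)" and v: "v \<in> carrier_vec (f0 * f ^ l)"
    and uK: "X ^ l * ((1 + \<epsilon>) ^ (l * max_row_nnz \<phi>) * (mat_norm q \<phi> ^ l * lp_norm q u)) \<le> K"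
    and vK: "X ^ l * ((1 + \<epsilon>) ^ (l * max_row_nnz \<psi>) * (mat_norm q \<psi> ^ l * lp_norm q v)) \<le> K"
    and fl: "fl_beta_mmab B e0 f0 g0 L R P \<phi> \<psi> \<nu> l \<epsilon> u v w"
  shows "lp_norm p (w - beta_mmab \<beta>0 e0 f0 g0 L R P \<phi> \<psi> \<nu> l u v)
    \<le> gamma_mmab p q L R P \<phi> \<psi> \<nu> ^ l
        * ((1 + \<epsilon>) ^ (l * (Q_ab L R P + max_row_nnz \<phi> + max_row_nnz \<psi> + max_row_nnz (transpose_mat \<nu>)))
          * (\<gamma>0 + c) - \<gamma>0) * (lp_norm q u * lp_norm q v)
      + mat_norm p (transpose_mat \<nu>) ^ l
        * ((1 + \<epsilon>) ^ (l * max_row_nnz (transpose_mat \<nu>)) * (slack_factor \<epsilon> ^ l * \<eta>))"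
proof -
  obtain u' v' w' where
    u': "fl_tensor_power \<epsilon> e0 \<phi> l u u'" and v': "fl_tensor_power \<epsilon> f0 \<psi> l v v'" and
    w': "fl_beta_ab B e0 f0 g0 L R P l \<epsilon> u' v' w'" and
    w: "fl_tensor_power \<epsilon> g0 (transpose_mat \<nu>) l w' w"
    using fl unfolding fl_beta_mmab_def by blast
  define x where "x = tensor_power e0 \<phi> l *\<^sub>v u"
  define y where "y = tensor_power f0 \<psi> l *\<^sub>v v"
  define a where "a = mat_norm q \<phi> ^ l * lp_norm q u"
  define b where "b = mat_norm q \<psi> ^ l * lp_norm q v"
  define G where "G = \<gamma> ^ l * \<gamma>0"
  define H where "H = \<gamma> ^ l * ((1 + \<epsilon>) ^ (l * Q_ab L R P) * (\<gamma>0 + c))"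
  define \<theta> where "\<theta> = slack_factor \<epsilon> ^ l * \<eta>"
  define \<sigma> where "\<sigma> = (1 + \<epsilon>) ^ (l * max_row_nnz \<phi>)"
  define \<tau> where "\<tau> = (1 + \<epsilon>) ^ (l * max_row_nnz \<psi>)"
  define \<kappa> where "\<kappa> = (1 + \<epsilon>) ^ (l * max_row_nnz (transpose_mat \<nu>))"
  let ?\<nu> = "transpose_mat \<nu>"
  have dims: "dim_row \<phi> = e'" "dim_col \<phi> = e" "dim_row \<psi> = f'" "dim_col \<psi> = f"
    "dim_row ?\<nu> = g" "dim_col ?\<nu> = g'"
    using \<phi> \<psi> \<nu> by auto
  have G: "0 \<le> G" using \<gamma>0 by (simp add: G_def gamma_ab_nonneg)
  have GH: "G \<le> H"
  proof -
    have "1 * \<gamma>0 \<le> (1 + \<epsilon>) ^ (l * Q_ab L R P) * (\<gamma>0 + c)"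
      using eps c \<gamma>0 by (intro mult_mono) auto
    then show ?thesis unfolding G_def H_def by (simp add: gamma_ab_nonneg mult_left_mono)
  qed
  have \<kappa>: "1 \<le> \<kappa>" using eps by (simp add: \<kappa>_def)
  have a: "0 \<le> a" by (simp add: a_def mat_norm_nonneg)
  have cx: "x \<in> carrier_vec (e0 * e' ^ l)" and cy: "y \<in> carrier_vec (f0 * f' ^ l)"
    using tensor_power_mult_carrier[of e0 \<phi> l u] tensor_power_mult_carrier[of f0 \<psi> l v]
    by (simp_all add: x_def y_def dims)
  have cu': "u' \<in> carrier_vec (e0 * e' ^ l)" and du: "lp_norm q (u' - x) \<le> (\<sigma> - 1) * a"
    using fl_tensor_power_error[OF q eps u'] u by (simp_all add: dims x_def a_def \<sigma>_def)
  have cv': "v' \<in> carrier_vec (f0 * f' ^ l)" and dv: "lp_norm q (v' - y) \<le> (\<tau> - 1) * b"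
    using fl_tensor_power_error[OF q eps v'] v by (simp_all add: dims y_def b_def \<tau>_def)
  have xa: "lp_norm q x \<le> a" and yb: "lp_norm q y \<le> b"
    using lp_norm_tensor_power_le[OF q, of u e0 \<phi> l] lp_norm_tensor_power_le[OF q, of v f0 \<psi> l] u v
    by (simp_all add: dims x_def y_def a_def b_def)
  have "lp_norm q u' \<le> \<sigma> * a" "lp_norm q v' \<le> \<tau> * b"
    using lp_norm_via_diff[OF q cu' cx] lp_norm_via_diff[OF q cv' cy] xa du yb dv
    by (simp_all add: left_diff_distrib)
  then have "X ^ l * lp_norm q u' \<le> X ^ l * (\<sigma> * a)" "X ^ l * lp_norm q v' \<le> X ^ l * (\<tau> * b)"
    using X by (auto intro: mult_left_mono)
  with uK vK have u'K: "X ^ l * lp_norm q u' \<le> K" and v'K: "X ^ l * lp_norm q v' \<le> K"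
    unfolding a_def b_def \<sigma>_def \<tau>_def by linarith+
  have ab: "w' \<in> carrier_vec (g0 * g' ^ l)"
    "lp_norm p (w' - \<beta> l u' v') \<le> (H - G) * (lp_norm q u' * lp_norm q v') + \<theta>"
    using fl_beta_ab_error[OF eps c \<eta> base XL XR X cu' cv' u'K v'K w']
    unfolding G_def H_def \<theta>_def by blast+
  have \<beta>_le: "lp_norm p (\<beta> l u v) \<le> G * (lp_norm q u * lp_norm q v)"
    if "u \<in> carrier_vec (e0 * e' ^ l)" "v \<in> carrier_vec (f0 * f' ^ l)" for u v
    unfolding G_def using that by (rule beta_norm_le)
  have w'_err: "lp_norm p (w' - \<beta> l x y) \<le> (\<sigma> * \<tau> * H - G) * (a * b) + \<theta>"
    by (rule bilinear_propagation[OF p q bilinear_map_beta_ab[OF bilinear L R P]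
          \<beta>_le G GH cx cu' cy cv' ab(1) xa du yb dv ab(2)])
  have cz: "\<beta> l x y \<in> carrier_vec (g0 * g' ^ l)" using cx cy by (rule beta_carrier)
  have "lp_norm p (\<beta> l x y) \<le> G * (lp_norm q x * lp_norm q y)"
    using cx cy by (rule \<beta>_le)
  also have "\<dots> \<le> G * (a * b)"
    using xa yb a G by (intro mult_left_mono mult_mono) auto
  finally have z: "lp_norm p (\<beta> l x y) \<le> G * (a * b)" .
  have cw: "w \<in> carrier_vec (g0 * dim_row ?\<nu> ^ l)"
    and w_err: "lp_norm p (w - tensor_power g0 ?\<nu> l *\<^sub>v w')
      \<le> (\<kappa> - 1) * (mat_norm p ?\<nu> ^ l * lp_norm p w')"
    using fl_tensor_power_error[OF p eps w] ab(1) \<nu> by (simp_all add: \<kappa>_def)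
  have "lp_norm p (w - tensor_power g0 ?\<nu> l *\<^sub>v \<beta> l x y)
      \<le> mat_norm p ?\<nu> ^ l * (\<kappa> * (\<sigma> * \<tau> * H * (a * b) + \<theta>) - G * (a * b))"
    using ab(1) cz w'_err unfolding dims(6)[symmetric]
    by (intro tensor_power_propagation[OF p \<kappa> cw _ _ w_err z]) (simp_all add: left_diff_distrib)
  also have "\<dots> = gamma_mmab p q L R P \<phi> \<psi> \<nu> ^ l
      * ((1 + \<epsilon>) ^ (l * (Q_ab L R P + max_row_nnz \<phi> + max_row_nnz \<psi> + max_row_nnz ?\<nu>))
        * (\<gamma>0 + c) - \<gamma>0) * (lp_norm q u * lp_norm q v)
      + mat_norm p ?\<nu> ^ l * (\<kappa> * \<theta>)"
    by (simp add: gamma_mmab_def G_def H_def \<kappa>_def \<sigma>_def \<tau>_def a_def b_def power_add power_mult_distrib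
        algebra_simps)
  finally show ?thesis
    unfolding beta_mmab_def transpose_tensor_power x_def[symmetric] y_def[symmetric] \<kappa>_def \<theta>_def .
qed

end


section \<open>Expansion to first order\<close>

lemma one_plus_power_le:
  fixes \<epsilon> :: real
  assumes "0 \<le> \<epsilon>" "\<epsilon> \<le> 1"
  shows "(1 + \<epsilon>) ^ n \<le> 1 + real n * \<epsilon> + 4 ^ n * \<epsilon>\<^sup>2"
proof (induction n)
  case (Suc n)
  have "real n \<le> 2 ^ n" by (simp add: less_imp_le)
  also have "\<dots> \<le> (4::real) ^ n" by (intro power_mono) auto
  finally have n: "real n \<le> 4 ^ n" .
  have "(1 + \<epsilon>) ^ Suc n \<le> (1 + \<epsilon>) * (1 + real n * \<epsilon> + 4 ^ n * \<epsilon>\<^sup>2)"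
    unfolding power_Suc using Suc.IH assms by (intro mult_left_mono) auto
  also have "\<dots> = 1 + real (Suc n) * \<epsilon> + (real n + 4 ^ n + 4 ^ n * \<epsilon>) * \<epsilon>\<^sup>2"
    by (simp add: algebra_simps power2_eq_square)
  also have "\<dots> \<le> 1 + real (Suc n) * \<epsilon> + 4 ^ Suc n * \<epsilon>\<^sup>2"
  proof -
    have "4 ^ n * \<epsilon> \<le> (4::real) ^ n" using assms by (simp add: mult_left_le)
    with n have "real n + 4 ^ n + 4 ^ n * \<epsilon> \<le> 4 ^ Suc n" unfolding power_Suc by linarith
    then show ?thesis by (intro add_left_mono mult_right_mono) auto
  qed
  finally show ?case .
qed simp

lemma amplified_constant_expansion:
  fixes \<epsilon> c a :: real
  assumes \<epsilon>: "0 \<le> \<epsilon>" "\<epsilon> \<le> 1" and c: "0 \<le> c" and a: "0 \<le> a"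
  shows "(1 + \<epsilon>) ^ n * (a + c * \<epsilon>) - a
    \<le> (c + a * real n) * \<epsilon> + (a * 4 ^ n + c * (real n + 4 ^ n)) * \<epsilon>\<^sup>2"
proof -
  have "(1 + \<epsilon>) ^ n * (a + c * \<epsilon>) \<le> (1 + real n * \<epsilon> + 4 ^ n * \<epsilon>\<^sup>2) * (a + c * \<epsilon>)"
    using assms one_plus_power_le[of \<epsilon> n] by (intro mult_right_mono) auto
  also have "\<dots> = a + (c + a * real n) * \<epsilon> + (a * 4 ^ n + c * (real n + 4 ^ n * \<epsilon>)) * \<epsilon>\<^sup>2"
    by (simp add: algebra_simps power2_eq_square)
  also have "\<dots> \<le> a + (c + a * real n) * \<epsilon> + (a * 4 ^ n + c * (real n + 4 ^ n)) * \<epsilon>\<^sup>2"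
    using \<epsilon> c by (intro add_left_mono mult_right_mono mult_left_mono) (auto simp: mult_left_le)
  finally show ?thesis by simp
qed

text \<open>An explicit multiple of \<open>\<epsilon>\<^sup>2\<close> can be carried through the recursion as a number for each fixed \<open>\<epsilon>\<close>.\<close>

lemma fl_error_boundD:
  assumes "fl_error_bound p q e f \<beta> B c"
  obtains C where "0 \<le> C" and "\<forall>\<^sub>F \<epsilon> in at_right 0. \<forall>u\<in>carrier_vec e. \<forall>v\<in>carrier_vec f.
    lp_norm q u \<le> K \<longrightarrow> lp_norm q v \<le> K \<longrightarrow>
      (\<forall>w. B \<epsilon> u v w \<longrightarrow> lp_norm p (w - \<beta> u v) \<le> c * lp_norm q u * lp_norm q v * \<epsilon> + C * \<epsilon>\<^sup>2)"
proof -
  obtain h where h: "h \<in> O[at_right 0](\<lambda>\<epsilon>. \<epsilon>\<^sup>2)"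
    and ev: "\<forall>\<^sub>F \<epsilon> in at_right (0::real). \<forall>u\<in>carrier_vec e. \<forall>v\<in>carrier_vec f.
      lp_norm q u \<le> K \<longrightarrow> lp_norm q v \<le> K \<longrightarrow>
        (\<forall>w. B \<epsilon> u v w \<longrightarrow> lp_norm p (w - \<beta> u v) \<le> c * lp_norm q u * lp_norm q v * \<epsilon> + h \<epsilon>)"
    using assms unfolding fl_error_bound_def by blast
  obtain C where C: "0 < C" "\<forall>\<^sub>F \<epsilon> in at_right 0. norm (h \<epsilon>) \<le> C * norm (\<epsilon>\<^sup>2)"
    using h by (rule landau_o.bigE)
  show thesis
  proof (rule that[of C])
    show "\<forall>\<^sub>F \<epsilon> in at_right 0. \<forall>u\<in>carrier_vec e. \<forall>v\<in>carrier_vec f.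
      lp_norm q u \<le> K \<longrightarrow> lp_norm q v \<le> K \<longrightarrow>
      (\<forall>w. B \<epsilon> u v w \<longrightarrow> lp_norm p (w - \<beta> u v) \<le> c * lp_norm q u * lp_norm q v * \<epsilon> + C * \<epsilon>\<^sup>2)"
      using ev C(2)
    proof eventually_elim
      case (elim \<epsilon>)
      then have "h \<epsilon> \<le> C * \<epsilon>\<^sup>2" by simp
      with elim(1) show ?case by (meson add_left_mono order_trans)
    qed
  qed (use C in simp)
qed

text \<open>If \<open>c\<close> were negative, the bound at a nonzero input would become negative for small \<open>\<epsilon>\<close>, while some value is
  always returned.\<close>

lemma fl_error_bound_nonneg:
  assumes q: "1 \<le> q" and dims: "0 < e" "0 < f"
    and comp: "fl_computation e f g B" and bound: "fl_error_bound p q e f \<beta> B c"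
  shows "0 \<le> c"
proof (rule ccontr)
  assume "\<not> 0 \<le> c"
  let ?u = "vec e (\<lambda>_. 1) :: real vec" and ?v = "vec f (\<lambda>_. 1) :: real vec"
  define N where "N = lp_norm q ?u * lp_norm q ?v"
  have N: "0 < N" using lp_norm_ones_pos[OF q] dims by (simp add: N_def)
  with \<open>\<not> 0 \<le> c\<close> have cN: "c * N < 0" by (simp add: mult_neg_pos)
  obtain C where C: "0 \<le> C" and ev: "\<forall>\<^sub>F \<epsilon> in at_right 0. \<forall>u\<in>carrier_vec e. \<forall>v\<in>carrier_vec f.
    lp_norm q u \<le> max (lp_norm q ?u) (lp_norm q ?v) \<longrightarrow> lp_norm q v \<le> max (lp_norm q ?u) (lp_norm q ?v) \<longrightarrow>
      (\<forall>w. B \<epsilon> u v w \<longrightarrow> lp_norm p (w - \<beta> u v) \<le> c * lp_norm q u * lp_norm q v * \<epsilon> + C * \<epsilon>\<^sup>2)"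
    using fl_error_boundD[OF bound] by blast
  have "\<forall>\<^sub>F \<epsilon> in at_right 0. \<epsilon> \<in> {0<..<- c * N / (C + 1)}"
    using cN C by (intro eventually_at_right_real) (simp add: field_simps)
  with ev have "\<forall>\<^sub>F \<epsilon> in at_right (0::real). False"
  proof eventually_elim
    case (elim \<epsilon>)
    then have \<epsilon>: "0 < \<epsilon>" "\<epsilon> * (C + 1) < - c * N" using C by (auto simp: field_simps)
    obtain w where "B \<epsilon> ?u ?v w"
      using comp \<epsilon>(1) unfolding fl_computation_def by (meson vec_carrier)
    with elim(1) have "lp_norm p (w - \<beta> ?u ?v) \<le> c * lp_norm q ?u * lp_norm q ?v * \<epsilon> + C * \<epsilon>\<^sup>2"
      by simp
    from order_trans[OF lp_norm_nonneg this] have "0 \<le> (c * N + C * \<epsilon>) * \<epsilon>"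
      by (simp add: N_def algebra_simps power2_eq_square)
    with \<epsilon>(1) have "0 \<le> c * N + C * \<epsilon>" by (simp add: zero_le_mult_iff)
    with \<epsilon> show ?case by (simp add: algebra_simps)
  qed
  then show False by simp
qed

theorem theorem23:
  fixes p q :: ereal
    and l m k n r e e' f f' g g' e0 f0 g0 :: nat
    and \<phi> \<psi> \<nu> L R P :: "real mat"
    and \<beta>0 :: "real vec \<Rightarrow> real vec \<Rightarrow> real vec"
    and B :: fl_map
    and \<gamma>0 c0 :: real
  assumes "1 \<le> p" and "1 \<le> q"
    and "0 < m" and "0 < k" and "0 < n" and "0 < e0" and "0 < f0" and "0 < g0"
    and "e = m * k" and "f = k * n" and "g = m * n"
    and "\<phi> \<in> carrier_mat e' e" and "\<psi> \<in> carrier_mat f' f" and "\<nu> \<in> carrier_mat g' g"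
    and "L \<in> carrier_mat r e'" and "R \<in> carrier_mat r f'" and "P \<in> carrier_mat g' r"
    and "represents (L * \<phi>) (R * \<psi>) (transpose_mat \<nu> * P) (matmul_map m k n)"
    and "bilinear_map e0 f0 g0 \<beta>0"
    and "\<And>u v. u \<in> carrier_vec e0 \<Longrightarrow> v \<in> carrier_vec f0 \<Longrightarrow>
           lp_norm p (\<beta>0 u v) \<le> \<gamma>0 * lp_norm q u * lp_norm q v"
    and "fl_computation e0 f0 g0 B"
    and "fl_error_bound p q e0 f0 \<beta>0 B c0"
  shows "fl_error_bound p q (e0 * e ^ l) (f0 * f ^ l)
           (beta_mmab \<beta>0 e0 f0 g0 L R P \<phi> \<psi> \<nu> l)
           (fl_beta_mmab B e0 f0 g0 L R P \<phi> \<psi> \<nu> l)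
           (gamma_mmab p q L R P \<phi> \<psi> \<nu> ^ l *
              (c0 + \<gamma>0 * real l *
                 real (Q_ab L R P + max_row_nnz \<phi> + max_row_nnz \<psi> + max_row_nnz (transpose_mat \<nu>))))"
proof -
  note p = assms(1) and q = assms(2) and e0 = assms(6) and f0 = assms(7)
    and \<phi> = assms(12) and \<psi> = assms(13) and \<nu> = assms(14) and comp = assms(21) and bound = assms(22)
  have c0: "0 \<le> c0" by (rule fl_error_bound_nonneg[OF q e0 f0 comp bound])
  have \<gamma>0: "0 \<le> \<gamma>0"
  proof -
    have "0 \<le> \<gamma>0 * lp_norm q (vec e0 (\<lambda>_. 1)) * lp_norm q (vec f0 (\<lambda>_. 1))"
      by (rule order_trans[OF lp_norm_nonneg assms(20)]) simp_all
    with lp_norm_ones_pos[OF q e0] lp_norm_ones_pos[OF q f0] show ?thesis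
      by (simp add: zero_le_mult_iff)
  qed
  interpret recursive_bilinear p q \<beta>0 e0 f0 g0 e' f' g' r L R P \<gamma>0
    using assms \<gamma>0 by unfold_locales auto
  let ?\<Gamma> = "gamma_mmab p q L R P \<phi> \<psi> \<nu> ^ l" and ?\<nu> = "transpose_mat \<nu>"
  let ?Q = "Q_ab L R P + max_row_nnz \<phi> + max_row_nnz \<psi> + max_row_nnz ?\<nu>"
  have \<Gamma>: "0 \<le> ?\<Gamma>" by (simp add: gamma_mmab_def gamma_ab_nonneg mat_norm_nonneg)
  \<comment> \<open>any bound on the growth per level that is uniform in \<open>\<epsilon> \<le> 1\<close> will do, since it only enters the \<open>O(\<epsilon>\<^sup>2)\<close> term\<close>
  define X where "X = (\<Sum>i<r. 2 ^ nnz (row L i) * lp_dual_norm q (row L i))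
    + (\<Sum>i<r. 2 ^ nnz (row R i) * lp_dual_norm q (row R i))"
  have sums: "0 \<le> (\<Sum>i<r. 2 ^ nnz (row A i) * lp_dual_norm q (row A i))"
    "i < r \<Longrightarrow> 2 ^ nnz (row A i) * lp_dual_norm q (row A i)
      \<le> (\<Sum>i<r. 2 ^ nnz (row A i) * lp_dual_norm q (row A i))" for A i
    by (auto intro!: sum_nonneg member_le_sum mult_nonneg_nonneg lp_dual_norm_nonneg[OF q])
  have X: "0 \<le> X" using sums(1) by (simp add: X_def)
  have XL: "2 ^ nnz (row L i) * lp_dual_norm q (row L i) \<le> X"
    and XR: "2 ^ nnz (row R i) * lp_dual_norm q (row R i) \<le> X" if "i < r" for i
    using sums(1)[of L] sums(1)[of R] sums(2)[OF that, of L] sums(2)[OF that, of R]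
    by (auto simp: X_def)
  show ?thesis
    unfolding fl_error_bound_def
  proof (intro allI)
    fix K :: real
    \<comment> \<open>bounds for the inputs of the base case when \<open>\<parallel>u\<parallel>, \<parallel>v\<parallel> \<le> K\<close> and \<open>1 + \<epsilon> \<le> 2\<close>\<close>
    let ?Ku = "X ^ l * (2 ^ (l * max_row_nnz \<phi>) * (mat_norm q \<phi> ^ l * \<bar>K\<bar>))"
    let ?Kv = "X ^ l * (2 ^ (l * max_row_nnz \<psi>) * (mat_norm q \<psi> ^ l * \<bar>K\<bar>))"
    obtain C where C: "0 \<le> C" and ev: "\<forall>\<^sub>F \<epsilon> in at_right 0. \<forall>u\<in>carrier_vec e0. \<forall>v\<in>carrier_vec f0.
      lp_norm q u \<le> max ?Ku ?Kv \<longrightarrow> lp_norm q v \<le> max ?Ku ?Kv \<longrightarrow>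
        (\<forall>w. B \<epsilon> u v w \<longrightarrow> lp_norm p (w - \<beta>0 u v) \<le> c0 * lp_norm q u * lp_norm q v * \<epsilon> + C * \<epsilon>\<^sup>2)"
      using fl_error_boundD[OF bound] by blast
    \<comment> \<open>\<open>A\<close> collects the second order terms of the expansion, \<open>S\<close> those inherited from the base case\<close>
    define A where "A = ?\<Gamma> * (\<gamma>0 * 4 ^ (l * ?Q) + c0 * (real (l * ?Q) + 4 ^ (l * ?Q))) * (\<bar>K\<bar> * \<bar>K\<bar>)"
    define S where "S = mat_norm p ?\<nu> ^ l * (2 ^ (l * max_row_nnz ?\<nu>) * (slack_factor 1 ^ l * C))"
    let ?h = "\<lambda>\<epsilon>. (A + S) * \<epsilon>\<^sup>2"
    have h: "?h \<in> O[at_right 0](\<lambda>\<epsilon>. \<epsilon>\<^sup>2)" by simp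
    have "\<forall>\<^sub>F \<epsilon> in at_right (0::real). \<epsilon> \<in> {0<..<1}"
      by (rule eventually_at_right_real) simp
    with ev have mmab_bound: "\<forall>\<^sub>F \<epsilon> in at_right (0::real). \<forall>u\<in>carrier_vec (e0 * e ^ l). \<forall>v\<in>carrier_vec (f0 * f ^ l).
      lp_norm q u \<le> K \<longrightarrow> lp_norm q v \<le> K \<longrightarrow>
        (\<forall>w. fl_beta_mmab B e0 f0 g0 L R P \<phi> \<psi> \<nu> l \<epsilon> u v w \<longrightarrow>
          lp_norm p (w - beta_mmab \<beta>0 e0 f0 g0 L R P \<phi> \<psi> \<nu> l u v)
          \<le> ?\<Gamma> * (c0 + \<gamma>0 * real l * real ?Q) * lp_norm q u * lp_norm q v * \<epsilon> + ?h \<epsilon>)"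
    proof eventually_elim
      case (elim \<epsilon>)
      then have \<epsilon>: "0 < \<epsilon>" "\<epsilon> \<le> 1" by auto
      have pow2: "(1 + \<epsilon>) ^ j \<le> 2 ^ j" for j using \<epsilon> by (intro power_mono) auto
      have base: "w \<in> carrier_vec g0 \<and> lp_norm p (w - \<beta>0 u v) \<le> c0 * \<epsilon> * (lp_norm q u * lp_norm q v) + C * \<epsilon>\<^sup>2"
        if "u \<in> carrier_vec e0" "v \<in> carrier_vec f0" "lp_norm q u \<le> max ?Ku ?Kv" "lp_norm q v \<le> max ?Ku ?Kv"
          "B \<epsilon> u v w" for u v w
        using that elim(1) comp \<epsilon>(1) unfolding fl_computation_def by (simp add: mult_ac)
      have XL': "(1 + \<epsilon>) ^ nnz (row L i) * lp_dual_norm q (row L i) \<le> X"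
        and XR': "(1 + \<epsilon>) ^ nnz (row R i) * lp_dual_norm q (row R i) \<le> X" if "i < r" for i
        using order_trans[OF mult_right_mono[OF pow2 lp_dual_norm_nonneg[OF q]] XL[OF that]]
          order_trans[OF mult_right_mono[OF pow2 lp_dual_norm_nonneg[OF q]] XR[OF that]] by auto
      show ?case
      proof (intro ballI impI allI)
        fix u v w
        assume u: "u \<in> carrier_vec (e0 * e ^ l)" and v: "v \<in> carrier_vec (f0 * f ^ l)"
          and uK: "lp_norm q u \<le> K" and vK: "lp_norm q v \<le> K"
          and w: "fl_beta_mmab B e0 f0 g0 L R P \<phi> \<psi> \<nu> l \<epsilon> u v w"
        define U where "U = lp_norm q u * lp_norm q v"
        have U: "0 \<le> U" "U \<le> \<bar>K\<bar> * \<bar>K\<bar>"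
          unfolding U_def using order_trans[OF uK abs_ge_self] order_trans[OF vK abs_ge_self]
          by (simp, intro mult_mono) simp_all
        have "X ^ l * ((1 + \<epsilon>) ^ (l * max_row_nnz \<phi>) * (mat_norm q \<phi> ^ l * lp_norm q u)) \<le> ?Ku"
          using uK \<epsilon> X pow2 by (intro mult_left_mono mult_mono) (auto simp: mat_norm_nonneg)
        then have Ku: "X ^ l * ((1 + \<epsilon>) ^ (l * max_row_nnz \<phi>) * (mat_norm q \<phi> ^ l * lp_norm q u)) \<le> max ?Ku ?Kv"
          by simp
        have "X ^ l * ((1 + \<epsilon>) ^ (l * max_row_nnz \<psi>) * (mat_norm q \<psi> ^ l * lp_norm q v)) \<le> ?Kv"
          using vK \<epsilon> X pow2 by (intro mult_left_mono mult_mono) (auto simp: mat_norm_nonneg)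
        then have Kv: "X ^ l * ((1 + \<epsilon>) ^ (l * max_row_nnz \<psi>) * (mat_norm q \<psi> ^ l * lp_norm q v)) \<le> max ?Ku ?Kv"
          by simp
        have "lp_norm p (w - beta_mmab \<beta>0 e0 f0 g0 L R P \<phi> \<psi> \<nu> l u v)
            \<le> ?\<Gamma> * ((1 + \<epsilon>) ^ (l * ?Q) * (\<gamma>0 + c0 * \<epsilon>) - \<gamma>0) * U
              + mat_norm p ?\<nu> ^ l * ((1 + \<epsilon>) ^ (l * max_row_nnz ?\<nu>) * (slack_factor \<epsilon> ^ l * (C * \<epsilon>\<^sup>2)))"
          unfolding U_def using \<epsilon> c0 C
          by (intro fl_beta_mmab_error[OF \<phi> \<psi> \<nu> _ _ _ base XL' XR' X u v Ku Kv w]) auto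
        also have "?\<Gamma> * ((1 + \<epsilon>) ^ (l * ?Q) * (\<gamma>0 + c0 * \<epsilon>) - \<gamma>0) * U
            \<le> ?\<Gamma> * (c0 + \<gamma>0 * real l * real ?Q) * U * \<epsilon> + A * \<epsilon>\<^sup>2"
        proof -
          define N where "N = l * ?Q"
          have "(1 + \<epsilon>) ^ N * (\<gamma>0 + c0 * \<epsilon>) - \<gamma>0
              \<le> (c0 + \<gamma>0 * real N) * \<epsilon> + (\<gamma>0 * 4 ^ N + c0 * (real N + 4 ^ N)) * \<epsilon>\<^sup>2"
            using \<epsilon> c0 \<gamma>0 by (intro amplified_constant_expansion) auto
          then have "?\<Gamma> * ((1 + \<epsilon>) ^ N * (\<gamma>0 + c0 * \<epsilon>) - \<gamma>0) * U
              \<le> ?\<Gamma> * ((c0 + \<gamma>0 * real N) * \<epsilon> + (\<gamma>0 * 4 ^ N + c0 * (real N + 4 ^ N)) * \<epsilon>\<^sup>2) * U"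
            using \<Gamma> U by (intro mult_right_mono mult_left_mono) auto
          also have "\<dots> = ?\<Gamma> * (c0 + \<gamma>0 * real N) * U * \<epsilon>
              + ?\<Gamma> * (\<gamma>0 * 4 ^ N + c0 * (real N + 4 ^ N)) * U * \<epsilon>\<^sup>2"
            by (simp add: algebra_simps)
          also have "?\<Gamma> * (\<gamma>0 * 4 ^ N + c0 * (real N + 4 ^ N)) * U * \<epsilon>\<^sup>2 \<le> A * \<epsilon>\<^sup>2"
            unfolding A_def N_def[symmetric] using \<Gamma> U c0 \<gamma>0
            by (intro mult_right_mono mult_left_mono) auto
          finally show ?thesis by (simp add: N_def mult.assoc)
        qed
        also have "mat_norm p ?\<nu> ^ l * ((1 + \<epsilon>) ^ (l * max_row_nnz ?\<nu>) * (slack_factor \<epsilon> ^ l * (C * \<epsilon>\<^sup>2)))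
            \<le> mat_norm p ?\<nu> ^ l * (2 ^ (l * max_row_nnz ?\<nu>) * (slack_factor 1 ^ l * (C * \<epsilon>\<^sup>2)))"
        proof -
          have "0 \<le> slack_factor \<epsilon>" "slack_factor \<epsilon> \<le> slack_factor 1"
            using \<epsilon> pow2 by (auto simp: slack_factor_def intro: mult_right_mono)
          then show ?thesis
            using C \<epsilon> pow2 by (intro mult_left_mono mult_mono power_mono) (auto simp: mat_norm_nonneg)
        qed
        also have "\<dots> = S * \<epsilon>\<^sup>2" by (simp add: S_def mult_ac)
        finally show "lp_norm p (w - beta_mmab \<beta>0 e0 f0 g0 L R P \<phi> \<psi> \<nu> l u v)
            \<le> ?\<Gamma> * (c0 + \<gamma>0 * real l * real ?Q) * lp_norm q u * lp_norm q v * \<epsilon> + ?h \<epsilon>"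
          unfolding U_def distrib_right[of A S] by (simp only: mult.assoc add.assoc)
      qed
    qed
    show "\<exists>h\<in>O[at_right 0](\<lambda>\<epsilon>. \<epsilon>\<^sup>2). \<forall>\<^sub>F \<epsilon> in at_right (0::real).
        \<forall>u\<in>carrier_vec (e0 * e ^ l). \<forall>v\<in>carrier_vec (f0 * f ^ l). lp_norm q u \<le> K \<longrightarrow> lp_norm q v \<le> K \<longrightarrow>
          (\<forall>w. fl_beta_mmab B e0 f0 g0 L R P \<phi> \<psi> \<nu> l \<epsilon> u v w \<longrightarrow>
             lp_norm p (w - beta_mmab \<beta>0 e0 f0 g0 L R P \<phi> \<psi> \<nu> l u v)
             \<le> ?\<Gamma> * (c0 + \<gamma>0 * real l * real ?Q) * lp_norm q u * lp_norm q v * \<epsilon> + h \<epsilon>)"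
      by (rule bexI[where x = ?h]) (fact mmab_bound, fact h)
  qed
qed

end
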